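(* The bit commitment scheme with classical communication described in the context satisfies $O(2^{-0.5\lambda})$-statistical binding: for every QPT sender $\{C^*_\lambda\}_\lambda$ there exists a (possibly inefficient) extractor $\mathcal E$ such that $$\Pr\left[\mu\ne b^*\ \wedge\ \mu\ne\bot\ :\ (\tau,\sigma_{C^*R})\leftarrow\mathsf{Commit}\langle C^*_\lambda,R_\lambda\rangle,\ b^*\leftarrow\mathcal E(\tau),\ \mu\leftarrow\mathsf{Reveal}\langle C^*_\lambda,R_\lambda,\sigma_{C^*R}\rangle\right]\le O(2^{-0.5\lambda}),$$ where $\tau$ is the (classical) transcript of the commit phase between $C^*_\lambda$ and the honest receiver $R_\lambda$, $\sigma_{C^*R}$ is the joint state after the commit phase, and $\mu\in\{0,1,\bot\}$ is the honest receiver's output in the reveal phase.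
   Context: PRFS. A QPT algorithm $G$ is a (selectively secure) $(d,n)$-PRFS generator if $G_\lambda(k,x)$, for $k\in\{0,1\}^\lambda,x\in\{0,1\}^{d(\lambda)}$, is an $n(\lambda)$-qubit state, and for all polynomials $s,t$, all non-uniform QPT distinguishers $A$ (polynomial-size quantum circuits with quantum advice) and all families of sets of inputs $\{x_1,\dots,x_{s(\lambda)}\}\subseteq\{0,1\}^{d(\lambda)}$ there is a negligible $\varepsilon$ such that $A_\lambda$, given $x_1,\dots,x_s$, distinguishes $G_\lambda(k,x_1)^{\otimes t},\dots,G_\lambda(k,x_s)^{\otimes t}$ (for uniform $k$) from $|\vartheta_1\rangle^{\otimes t},\dots,|\vartheta_s\rangle^{\otimes t}$ (for independent Haar-random $n$-qubit states $|\vartheta_i\rangle$) with advantage at most $\varepsilon(\lambda)$. $G$ has the recognizable abort property if there are a QPT algorithm $\widehat G$ and an $(n+1)$-qubit state $|\bot\rangle=|1\rangle|\widehat\bot\rangle$ such that $\widehat G_\lambda(k,x)=\eta_{k,x}\,|0\rangle\langle0|\otimes|\psi_{k,x}\rangle\langle\psi_{k,x}|+(1-\eta_{k,x})|\bot\rangle\langle\bot|$ for some $\eta_{k,x}\in[0,1]$ and $n$-qubit pure state $|\psi_{k,x}\rangle$, and $G_\lambda(k,x)$ is obtained from $\widehat G_\lambda(k,x)$ by tracing out the first qubit. Parameters. $n(\lambda)=\lceil3\log_2\lambda\rceil$, $d(\lambda)=\lceil\log_2(3\lambda/n)\rceil\ge1$, $m=2^dn$ (so $m\ge3\lambda$), $L=3^8\,2^{3(n+1)+2}\lambda$.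 $G$ is a $(d,n)$-PRFS generator with recognizable abort. $\mathcal P_n$ is the set of $4^n$ $n$-qubit Pauli operators (tensor products of $I,X,Y,Z$). For $P_x\in\mathcal P_n$, $k\in\{0,1\}^\lambda$, $x\in\{0,1\}^d$, $b\in\{0,1\}$, let $\Phi_\lambda(P_x,k,x,b)=(I\otimes P_x^b)\,\widehat G_\lambda(k,x)\,(I\otimes P_x^b)$, a $2^{n+1}$-dimensional density matrix. Tomography. $\mathcal T$ is a tomography procedure that given $sN^2$ copies of an $N$-dimensional density matrix $\rho$ outputs a matrix $M$ with $\mathbb E\|M-\rho\|_F^2\le N/s$, in time $\mathrm{poly}(s,N)$ (such a procedure exists). $\mathcal T_{\rm imp}$, given $4sN^2\lambda$ copies of $\rho$, runs $\mathcal T(\rho^{\otimes4sN^2})$ independently $\lambda$ times to get $M_1,\dots,M_\lambda$ and outputs some $M_{i^*}$ with $|\{j:\|M_j-M_{i^*}\|_F^2\le4N/s\}|>\lambda/2$, or $\bot$ if none exists. $\mathsf{Tomography}(\rho^{\otimes L})=\mathcal T_{\rm imp}(\rho^{\otimes L})$ with $N=2^{n+1}$, $s=3^8 2^{n+1}$. $\mathsf{Verify}(\mathbf x,M)$: compute $\widehat M\leftarrow\mathsf{Tomography}(\Phi_\lambda(\mathbf x)^{\otimes L})$; output $\mathsf{Invalid}$ if $\langle\bot|M|\bot\rangle>\frac19$; otherwise output $\mathsf{Valid}$ if $\|M-\widehat M\|_F^2\le\frac4{729}$ and $\mathsf{Invalid}$ otherwise (also $\mathsf{Invalid}$ if $M$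 is not a density matrix or $\widehat M$ is the failure symbol). $\|\cdot\|_F$ is the Frobenius norm. Commitment scheme. Commit: the receiver samples $P=\bigotimes_{x\in\{0,1\}^d}P_x$ with independent uniform $P_x\in\mathcal P_n$ and sends $P$. The (honest) committer, on input $b$, samples $k\leftarrow\{0,1\}^\lambda$ uniformly, and for each $x\in\{0,1\}^d$ computes $M_x\leftarrow\mathsf{Tomography}(\Phi_\lambda(P_x,k,x,b)^{\otimes L})$; it sends $M=(M_x)_{x\in\{0,1\}^d}$. The transcript is $\tau=(P,M)$. Reveal: the committer sends $(k,b)$. The receiver outputs $\bot$ if $b\notin\{0,1\}$; it outputs $b$ if $\mathsf{Verify}((P_x,k,x,b),M_x)=\mathsf{Valid}$ for every $x\in\{0,1\}^d$, and $\bot$ otherwise. *)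

theory Defs
  imports
    "HOL-Probability.Probability"
    "HOL-Library.Landau_Symbols"
    "HOL-Library.Monad_Syntax"
    "Jordan_Normal_Form.Schur_Decomposition"
begin

text \<open>
  A \<open>q\<close>-qubit operator is a \<open>complex mat\<close> of dimension \<open>2 ^ q\<close>. Qubit \<open>0\<close> is the first tensor
  factor, i.e. the most significant bit of a row or column index.
\<close>

definition tensor_mat :: "complex mat \<Rightarrow> complex mat \<Rightarrow> complex mat" where
  "tensor_mat A B =
     Matrix.mat (dim_row A * dim_row B) (dim_col A * dim_col B)
       (\<lambda>(i, j). A $$ (i div dim_row B, j div dim_col B) * B $$ (i mod dim_row B, j mod dim_col B))"

definition tensor_list :: "complex mat list \<Rightarrow> complex mat" where
  "tensor_list As = foldr tensor_mat As (1\<^sub>m 1)"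

definition tensor_pow :: "complex mat \<Rightarrow> nat \<Rightarrow> complex mat" where
  "tensor_pow A t = tensor_list (replicate t A)"

definition tensor_vec :: "complex Matrix.vec \<Rightarrow> complex Matrix.vec \<Rightarrow> complex Matrix.vec" where
  "tensor_vec u v =
     Matrix.vec (dim_vec u * dim_vec v)
       (\<lambda>i. vec_index u (i div dim_vec v) * vec_index v (i mod dim_vec v))"

definition proj :: "complex Matrix.vec \<Rightarrow> complex mat" where
  "proj v = Matrix.mat (dim_vec v) (dim_vec v) (\<lambda>(i, j). vec_index v i * cnj (vec_index v j))"

definition ptrace_fst :: "nat \<Rightarrow> complex mat \<Rightarrow> complex mat" where
  "ptrace_fst r A =
     (let m = dim_row A div r
      in Matrix.mat m m (\<lambda>(i, j). \<Sum>k<r. A $$ (k * m + i, k * m + j)))"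

definition ptrace_snd :: "nat \<Rightarrow> complex mat \<Rightarrow> complex mat" where
  "ptrace_snd r A =
     (let m = dim_row A div r
      in Matrix.mat m m (\<lambda>(i, j). \<Sum>k<r. A $$ (i * r + k, j * r + k)))"

definition frob_norm :: "complex mat \<Rightarrow> real" where
  "frob_norm A = sqrt (\<Sum>i<dim_row A. \<Sum>j<dim_col A. (cmod (A $$ (i, j)))\<^sup>2)"

definition unitary_mat :: "nat \<Rightarrow> complex mat \<Rightarrow> bool" where
  "unitary_mat N U \<longleftrightarrow> U \<in> carrier_mat N N \<and> U * mat_adjoint U = 1\<^sub>m N"

definition density_matrix :: "nat \<Rightarrow> complex mat \<Rightarrow> bool" where
  "density_matrix N A \<longleftrightarrow>
     A \<in> carrier_mat N N \<and> mat_adjoint A = A \<and>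
     (\<forall>v \<in> carrier_vec N. 0 \<le> Re ((A *\<^sub>v v) \<bullet>c v)) \<and>
     (\<Sum>i<N. A $$ (i, i)) = 1"

definition pure_state :: "nat \<Rightarrow> complex Matrix.vec \<Rightarrow> bool" where
  "pure_state q v \<longleftrightarrow> v \<in> carrier_vec (2 ^ q) \<and> (\<Sum>i<2 ^ q. (cmod (vec_index v i))\<^sup>2) = 1"

definition nat_of_bits :: "bool list \<Rightarrow> nat" where
  "nat_of_bits bs = horner_sum of_bool 2 (rev bs)"

definition ket :: "bool list \<Rightarrow> complex Matrix.vec" where
  "ket bs = unit_vec (2 ^ length bs) (nat_of_bits bs)"

definition poly_bounded :: "(nat \<Rightarrow> nat) \<Rightarrow> bool" where
  "poly_bounded f \<longleftrightarrow> (\<exists>c. \<forall>l. f l \<le> c * l ^ c + c)"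

definition negligible :: "(nat \<Rightarrow> real) \<Rightarrow> bool" where
  "negligible \<epsilon> \<longleftrightarrow> (\<forall>c::nat. \<forall>\<^sub>F l in sequentially. \<bar>\<epsilon> l\<bar> \<le> 1 / real l ^ c)"

text \<open>
  Deterministic single-tape Turing machines with a two-way infinite tape. State \<open>0\<close> is initial and
  state \<open>1\<close> is halting; symbol \<open>0\<close> is the blank, and \<open>1\<close>, \<open>2\<close> encode \<open>False\<close>, \<open>True\<close>. The third
  component of a transition is the head movement.
\<close>

datatype tm = TM (tm_states: nat) (tm_symbols: nat) (tm_delta: "nat \<Rightarrow> nat \<Rightarrow> nat \<times> nat \<times> int")

definition wf_tm :: "tm \<Rightarrow> bool" where
  "wf_tm M \<longleftrightarrow> 2 \<le> tm_states M \<and> 3 \<le> tm_symbols M \<and>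
     (\<forall>q<tm_states M. \<forall>a<tm_symbols M.
        tm_delta M q a \<in> {..<tm_states M} \<times> {..<tm_symbols M} \<times> {-1, 0, 1})"

definition bits_tape :: "bool list \<Rightarrow> int \<Rightarrow> nat" where
  "bits_tape bs i =
     (if 0 \<le> i \<and> i < int (length bs) then (if bs ! nat i then 2 else 1) else 0)"

fun tm_step :: "tm \<Rightarrow> nat \<times> (int \<Rightarrow> nat) \<times> int \<Rightarrow> nat \<times> (int \<Rightarrow> nat) \<times> int" where
  "tm_step M (q, tp, h) =
     (if q = 1 then (q, tp, h)
      else case tm_delta M q (tp h) of (q', a, mv) \<Rightarrow> (q', tp(h := a), h + mv))"

definition poly_time :: "(bool list \<Rightarrow> bool list) \<Rightarrow> bool" where
  "poly_time f \<longleftrightarrow>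
     (\<exists>M T. wf_tm M \<and> poly_bounded T \<and>
        (\<forall>x. \<exists>h. (tm_step M ^^ T (length x)) (0, bits_tape x, 0) = (1, bits_tape (f x), h)))"

text \<open>
  Generalized circuits over the gate set H, T, CNOT: the input qubits are followed by ancillas
  initialised to zero, and at the end all qubits but the first \<open>outputs\<close> ones are traced out.
\<close>

datatype gate = HGate nat | TGate nat | CNOT nat nat

datatype circuit =
  Circuit (inputs: nat) (ancillas: nat) (gates: "gate list") (outputs: nat)

definition wires :: "circuit \<Rightarrow> nat" where
  "wires C = inputs C + ancillas C"

fun wf_gate :: "nat \<Rightarrow> gate \<Rightarrow> bool" where
  "wf_gate w (HGate q) \<longleftrightarrow> q < w"
| "wf_gate w (TGate q) \<longleftrightarrow> q < w"
| "wf_gate w (CNOT c t) \<longleftrightarrow> c < w \<and> t < w \<and> c \<noteq> t"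

definition wf_circuit :: "circuit \<Rightarrow> bool" where
  "wf_circuit C \<longleftrightarrow> outputs C \<le> wires C \<and> (\<forall>g \<in> set (gates C). wf_gate (wires C) g)"

definition circuit_size :: "circuit \<Rightarrow> nat" where
  "circuit_size C = wires C + length (gates C) + outputs C"

definition on_qubit :: "nat \<Rightarrow> nat \<Rightarrow> complex mat \<Rightarrow> complex mat" where
  "on_qubit w q U = tensor_list [1\<^sub>m (2 ^ q), U, 1\<^sub>m (2 ^ (w - q - 1))]"

fun gate_mat :: "nat \<Rightarrow> gate \<Rightarrow> complex mat" where
  "gate_mat w (HGate q) =
     on_qubit w q (complex_of_real (1 / sqrt 2) \<cdot>\<^sub>m mat_of_rows_list 2 [[1, 1], [1, -1]])"
| "gate_mat w (TGate q) =
     on_qubit w q (mat_of_rows_list 2 [[1, 0], [0, cis (pi / 4)]])"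
| "gate_mat w (CNOT c t) =
     Matrix.mat (2 ^ w) (2 ^ w)
       (\<lambda>(i, j). of_bool (i = (if bit j (w - c - 1) then flip_bit (w - t - 1) j else j)))"

definition circuit_unitary :: "circuit \<Rightarrow> complex mat" where
  "circuit_unitary C =
     foldl (\<lambda>U g. gate_mat (wires C) g * U) (1\<^sub>m (2 ^ wires C)) (gates C)"

definition run :: "circuit \<Rightarrow> complex mat \<Rightarrow> complex mat" where
  "run C \<rho> =
     ptrace_snd (2 ^ (wires C - outputs C))
       (circuit_unitary C * tensor_mat \<rho> (proj (ket (replicate (ancillas C) False)))
          * mat_adjoint (circuit_unitary C))"

text \<open>
  Measuring the first \<open>a\<close> qubits of \<open>\<sigma>\<close> in the computational basis: \<open>branch a \<sigma> bs\<close> is the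
  subnormalised state of the other qubits for outcome \<open>bs\<close>, whose trace is the probability of \<open>bs\<close>.
\<close>

definition branch :: "nat \<Rightarrow> complex mat \<Rightarrow> bool list \<Rightarrow> complex mat" where
  "branch a \<sigma> bs =
     (let r = dim_row \<sigma> div 2 ^ a; v = nat_of_bits bs
      in Matrix.mat r r (\<lambda>(i, j). \<sigma> $$ (v * r + i, v * r + j)))"

definition branch_prob :: "nat \<Rightarrow> complex mat \<Rightarrow> bool list \<Rightarrow> real" where
  "branch_prob a \<sigma> bs =
     (if length bs = a then Re (\<Sum>i<dim_row (branch a \<sigma> bs). branch a \<sigma> bs $$ (i, i)) else 0)"

definition measure_first :: "nat \<Rightarrow> complex mat \<Rightarrow> bool list pmf" where
  "measure_first a \<sigma> = embed_pmf (branch_prob a \<sigma>)"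

definition post_state :: "nat \<Rightarrow> complex mat \<Rightarrow> bool list \<Rightarrow> complex mat" where
  "post_state a \<sigma> bs = complex_of_real (1 / branch_prob a \<sigma> bs) \<cdot>\<^sub>m branch a \<sigma> bs"

definition run_measure :: "circuit \<Rightarrow> complex mat \<Rightarrow> bool list pmf" where
  "run_measure C \<rho> = measure_first (outputs C) (run C \<rho>)"

fun gate_code :: "gate \<Rightarrow> nat list" where
  "gate_code (HGate q) = [0, q]"
| "gate_code (TGate q) = [1, q]"
| "gate_code (CNOT c t) = [2, c, t]"

text \<open>
  The description of a circuit has all its numbers in unary, so its length is polynomial in the
  size of the circuit.
\<close>

definition circuit_code :: "circuit \<Rightarrow> bool list" where
  "circuit_code C =
     concat (map (\<lambda>k. replicate k True @ [False])
       ([inputs C, ancillas C, outputs C] @ concat (map gate_code (gates C))))"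

definition poly_size :: "(nat \<Rightarrow> circuit) \<Rightarrow> bool" where
  "poly_size C \<longleftrightarrow> (\<forall>l. wf_circuit (C l)) \<and> poly_bounded (\<lambda>l. circuit_size (C l))"

definition qpt :: "(nat \<Rightarrow> circuit) \<Rightarrow> bool" where
  "qpt C \<longleftrightarrow> poly_size C \<and> (\<exists>f. poly_time f \<and> (\<forall>l. f (replicate l True) = circuit_code (C l)))"

text \<open>
  The Haar measure on pure states is the unitarily invariant probability measure on the unit
  sphere; vectors are represented as functions on \<open>{..<N}\<close>.
\<close>

definition is_haar :: "nat \<Rightarrow> (nat \<Rightarrow> complex) measure \<Rightarrow> bool" where
  "is_haar N \<mu> \<longleftrightarrow>
     prob_space \<mu> \<and> sets \<mu> = sets (\<Pi>\<^sub>M i\<in>{..<N}. borel) \<and>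
     (AE v in \<mu>. (\<Sum>i<N. (cmod (v i))\<^sup>2) = 1) \<and>
     (\<forall>U. unitary_mat N U \<longrightarrow>
        distr \<mu> \<mu> (\<lambda>v. \<lambda>i\<in>{..<N}. \<Sum>j<N. U $$ (i, j) * v j) = \<mu>)"

definition haar :: "nat \<Rightarrow> (nat \<Rightarrow> complex) measure" where
  "haar N = (THE \<mu>. is_haar N \<mu>)"

definition eval_gen :: "circuit \<Rightarrow> bool list \<Rightarrow> bool list \<Rightarrow> complex mat" where
  "eval_gen C k x = run C (proj (ket (k @ x)))"

definition accept_prob :: "circuit \<Rightarrow> complex mat list \<Rightarrow> real" where
  "accept_prob A \<rho>s = pmf (run_measure A (tensor_list \<rho>s)) [True]"

definition real_prob ::
  "circuit \<Rightarrow> circuit \<Rightarrow> complex mat \<Rightarrow> nat \<Rightarrow> bool list list \<Rightarrow> nat \<Rightarrow> real" where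
  "real_prob G A adv lam xs t =
     measure_pmf.expectation (pmf_of_set {k. length k = lam})
       (\<lambda>k. accept_prob A
          (proj (ket (concat xs)) # concat (map (\<lambda>x. replicate t (eval_gen G k x)) xs) @ [adv]))"

definition ideal_prob ::
  "nat \<Rightarrow> circuit \<Rightarrow> complex mat \<Rightarrow> bool list list \<Rightarrow> nat \<Rightarrow> real" where
  "ideal_prob n A adv xs t =
     (\<integral>\<theta>. accept_prob A
          (proj (ket (concat xs)) #
           concat (map (\<lambda>i. replicate t (proj (Matrix.vec (2 ^ n) (\<theta> i)))) [0..<length xs]) @ [adv])
        \<partial>(\<Pi>\<^sub>M i\<in>{..<length xs}. haar (2 ^ n)))"

text \<open>
  The numbers \<open>s\<close> of inputs and \<open>t\<close> of copies are polynomially bounded functions: as the inputs are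
  pairwise distinct, \<open>s lam \<le> 2 ^ d lam\<close>, which an actual polynomial in \<open>lam\<close> could not satisfy in
  general. The distinguisher is a polynomial-size circuit family \<open>A\<close> with advice \<open>adv lam\<close> on
  \<open>a lam\<close> qubits.
\<close>

definition prfs_generator :: "(nat \<Rightarrow> nat) \<Rightarrow> (nat \<Rightarrow> nat) \<Rightarrow> (nat \<Rightarrow> circuit) \<Rightarrow> bool" where
  "prfs_generator d n G \<longleftrightarrow>
     qpt G \<and> (\<forall>lam. inputs (G lam) = lam + d lam \<and> outputs (G lam) = n lam) \<and>
     (\<forall>s t A a adv xs.
        poly_bounded s \<longrightarrow> poly_bounded t \<longrightarrow> poly_size A \<longrightarrow>
        (\<forall>lam. inputs (A lam) = s lam * d lam + s lam * t lam * n lam + a lam \<and>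
               outputs (A lam) = 1 \<and> density_matrix (2 ^ a lam) (adv lam)) \<longrightarrow>
        (\<forall>lam. length (xs lam) = s lam \<and> distinct (xs lam) \<and>
               (\<forall>x \<in> set (xs lam). length x = d lam)) \<longrightarrow>
        (\<exists>\<epsilon>. negligible \<epsilon> \<and>
           (\<forall>lam. \<bar>real_prob (G lam) (A lam) (adv lam) lam (xs lam) (t lam)
                  - ideal_prob (n lam) (A lam) (adv lam) (xs lam) (t lam)\<bar> \<le> \<epsilon> lam)))"

definition recognizable_abort ::
  "(nat \<Rightarrow> nat) \<Rightarrow> (nat \<Rightarrow> nat) \<Rightarrow> (nat \<Rightarrow> circuit) \<Rightarrow> (nat \<Rightarrow> circuit) \<Rightarrow>
   (nat \<Rightarrow> complex Matrix.vec) \<Rightarrow> bool" where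
  "recognizable_abort d n G Ghat abt \<longleftrightarrow>
     qpt Ghat \<and> (\<forall>lam. inputs (Ghat lam) = lam + d lam \<and> outputs (Ghat lam) = n lam + 1) \<and>
     (\<forall>lam. \<exists>bh. pure_state (n lam) bh \<and> abt lam = tensor_vec (ket [True]) bh) \<and>
     (\<forall>lam k x. length k = lam \<longrightarrow> length x = d lam \<longrightarrow>
        (\<exists>\<eta>::real. \<exists>\<psi>. 0 \<le> \<eta> \<and> \<eta> \<le> 1 \<and> pure_state (n lam) \<psi> \<and>
           eval_gen (Ghat lam) k x =
             complex_of_real \<eta> \<cdot>\<^sub>m tensor_mat (proj (ket [False])) (proj \<psi>)
             + complex_of_real (1 - \<eta>) \<cdot>\<^sub>m proj (abt lam)) \<and>
        eval_gen (G lam) k x = ptrace_fst 2 (eval_gen (Ghat lam) k x))"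

definition n_par :: "nat \<Rightarrow> nat" where
  "n_par lam = nat \<lceil>3 * log 2 (real lam)\<rceil>"

definition d_par :: "nat \<Rightarrow> nat" where
  "d_par lam = nat \<lceil>log 2 (3 * real lam / real (n_par lam))\<rceil>"

text \<open>
  Matrices are transmitted as bit strings. A real number is a sign bit followed by a fixed-point
  binary number, half of whose bits are fractional; an \<open>N\<close>-dimensional matrix is the concatenation
  of \<open>2 * N * N\<close> real numbers of equal, but arbitrary, length.
\<close>

fun real_of_bits :: "bool list \<Rightarrow> real" where
  "real_of_bits [] = 0"
| "real_of_bits (sg # bs) =
     (if sg then -1 else 1) * real (nat_of_bits bs) / 2 ^ (length bs div 2)"

definition block :: "nat \<Rightarrow> nat \<Rightarrow> bool list \<Rightarrow> bool list" where
  "block m i bs = (let w = length bs div m in take w (drop (i * w) bs))"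

definition mat_of_bits :: "nat \<Rightarrow> bool list \<Rightarrow> complex mat" where
  "mat_of_bits N bs =
     Matrix.mat N N (\<lambda>(i, j).
       Complex (real_of_bits (block (2 * N * N) (2 * (i * N + j)) bs))
               (real_of_bits (block (2 * N * N) (2 * (i * N + j) + 1) bs)))"

text \<open>
  An \<open>N\<close>-dimensional system is stored in \<open>qubits N\<close> qubits; \<open>pad_mat N \<rho> = \<rho>\<close> if \<open>N\<close> is a power of two.
\<close>

definition qubits :: "nat \<Rightarrow> nat" where
  "qubits N = nat \<lceil>log 2 (real N)\<rceil>"

definition pad_mat :: "nat \<Rightarrow> complex mat \<Rightarrow> complex mat" where
  "pad_mat N \<rho> =
     Matrix.mat (2 ^ qubits N) (2 ^ qubits N) (\<lambda>(i, j). if i < N \<and> j < N then \<rho> $$ (i, j) else 0)"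

definition tomo :: "(nat \<Rightarrow> nat \<Rightarrow> circuit) \<Rightarrow> nat \<Rightarrow> nat \<Rightarrow> complex mat \<Rightarrow> complex mat pmf" where
  "tomo T s N \<rho> =
     map_pmf (mat_of_bits N) (run_measure (T s N) (tensor_pow (pad_mat N \<rho>) (s * N\<^sup>2)))"

definition tomography_procedure :: "(nat \<Rightarrow> nat \<Rightarrow> circuit) \<Rightarrow> bool" where
  "tomography_procedure T \<longleftrightarrow>
     (\<exists>f. poly_time f \<and>
        (\<forall>s\<ge>1. \<forall>N\<ge>1. f (replicate s True @ False # replicate N True) = circuit_code (T s N))) \<and>
     (\<forall>s\<ge>1. \<forall>N\<ge>1. wf_circuit (T s N) \<and> inputs (T s N) = s * N\<^sup>2 * qubits N \<and>
        (\<forall>\<rho>. density_matrix N \<rho> \<longrightarrow>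
           (\<integral>\<^sup>+ M. ennreal ((frob_norm (M - \<rho>))\<^sup>2) \<partial>measure_pmf (tomo T s N \<rho>))
             \<le> ennreal (real N / real s)))"

text \<open>
  The improved procedure runs \<open>T\<close> on \<open>4 * s * N\<^sup>2\<close> copies, i.e. with parameter \<open>4 * s\<close>, and returns
  the first estimate that is close to a majority of all the estimates.
\<close>

definition select_mat :: "real \<Rightarrow> complex mat list \<Rightarrow> complex mat option" where
  "select_mat \<delta> Ms =
     find (\<lambda>M. 2 * length (filter (\<lambda>M'. (frob_norm (M' - M))\<^sup>2 \<le> \<delta>) Ms) > length Ms) Ms"

definition tomo_imp ::
  "(nat \<Rightarrow> nat \<Rightarrow> circuit) \<Rightarrow> nat \<Rightarrow> nat \<Rightarrow> nat \<Rightarrow> complex mat \<Rightarrow> complex mat option pmf" where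
  "tomo_imp T s N lam \<rho> =
     map_pmf (select_mat (4 * real N / real s)) (replicate_pmf lam (tomo T (4 * s) N \<rho>))"

text \<open>In total this consumes \<open>3 ^ 8 * 2 ^ (3 * (n_par lam + 1) + 2) * lam\<close> copies of \<open>\<rho>\<close>.\<close>

definition tomography ::
  "(nat \<Rightarrow> nat \<Rightarrow> circuit) \<Rightarrow> nat \<Rightarrow> complex mat \<Rightarrow> complex mat option pmf" where
  "tomography T lam \<rho> =
     tomo_imp T (3 ^ 8 * 2 ^ (n_par lam + 1)) (2 ^ (n_par lam + 1)) lam \<rho>"

datatype pauli = PauliI | PauliX | PauliY | PauliZ

fun pauli1 :: "pauli \<Rightarrow> complex mat" where
  "pauli1 PauliI = 1\<^sub>m 2"
| "pauli1 PauliX = mat_of_rows_list 2 [[0, 1], [1, 0]]"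
| "pauli1 PauliY = mat_of_rows_list 2 [[0, - \<i>], [\<i>, 0]]"
| "pauli1 PauliZ = mat_of_rows_list 2 [[1, 0], [0, -1]]"

definition pauli_mat :: "pauli list \<Rightarrow> complex mat" where
  "pauli_mat p = tensor_list (map pauli1 p)"

fun pauli_code :: "pauli \<Rightarrow> bool list" where
  "pauli_code PauliI = [False, False]"
| "pauli_code PauliX = [False, True]"
| "pauli_code PauliY = [True, False]"
| "pauli_code PauliZ = [True, True]"

definition Phi ::
  "(nat \<Rightarrow> circuit) \<Rightarrow> nat \<Rightarrow> pauli list \<Rightarrow> bool list \<Rightarrow> bool list \<Rightarrow> bool \<Rightarrow> complex mat" where
  "Phi Ghat lam p k x b =
     (let Q = tensor_mat (1\<^sub>m 2) (if b then pauli_mat p else 1\<^sub>m (2 ^ n_par lam))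
      in Q * eval_gen (Ghat lam) k x * Q)"

datatype verdict = Valid | Invalid

definition verify ::
  "(nat \<Rightarrow> nat \<Rightarrow> circuit) \<Rightarrow> (nat \<Rightarrow> circuit) \<Rightarrow> (nat \<Rightarrow> complex Matrix.vec) \<Rightarrow> nat \<Rightarrow>
   pauli list \<Rightarrow> bool list \<Rightarrow> bool list \<Rightarrow> bool \<Rightarrow> complex mat \<Rightarrow> verdict pmf" where
  "verify T Ghat abt lam p k x b M =
     do {
       Mhat \<leftarrow> tomography T lam (Phi Ghat lam p k x b);
       return_pmf
         (if \<not> density_matrix (2 ^ (n_par lam + 1)) M then Invalid
          else if Re ((M *\<^sub>v abt lam) \<bullet>c abt lam) > 1 / 9 then Invalid
          else case Mhat of
            None \<Rightarrow> Invalid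
          | Some M' \<Rightarrow> if (frob_norm (M - M'))\<^sup>2 \<le> 4 / 729 then Valid else Invalid)
     }"

text \<open>
  The transcript consists of the receiver's Pauli operators and of the bit string sent by the
  sender, which is read as \<open>2 ^ d\<close> matrices.
\<close>

type_synonym transcript = "(bool list \<Rightarrow> pauli list) \<times> bool list"

definition committed_mat :: "nat \<Rightarrow> bool list \<Rightarrow> bool list \<Rightarrow> complex mat" where
  "committed_mat lam msg x =
     mat_of_bits (2 ^ (n_par lam + 1)) (block (2 ^ d_par lam) (nat_of_bits x) msg)"

definition receiver_paulis :: "nat \<Rightarrow> (bool list \<Rightarrow> pauli list) pmf" where
  "receiver_paulis lam =
     Pi_pmf {x. length x = d_par lam} [] (\<lambda>_. pmf_of_set {p. length p = n_par lam})"

definition paulis_code :: "nat \<Rightarrow> (bool list \<Rightarrow> pauli list) \<Rightarrow> bool list" where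
  "paulis_code lam P =
     concat (map (\<lambda>x. concat (map pauli_code (P x))) (List.n_lists (d_par lam) [False, True]))"

text \<open>
  A malicious sender consists, for each security parameter, of a circuit for the commit phase, a
  circuit for the reveal phase and an advice state. The first circuit gets the Pauli operators and
  the advice; its first \<open>msg_len\<close> output qubits are measured to give the message, and its other
  output qubits are the register kept for the reveal phase. The output qubits of the second circuit
  are measured to give the opening.
\<close>

datatype sender =
  Sender (commit_circ: "nat \<Rightarrow> circuit") (reveal_circ: "nat \<Rightarrow> circuit")
    (msg_len: "nat \<Rightarrow> nat") (advice_len: "nat \<Rightarrow> nat") (advice: "nat \<Rightarrow> complex mat")

definition qpt_sender :: "sender \<Rightarrow> bool" where
  "qpt_sender S \<longleftrightarrow>
     poly_size (commit_circ S) \<and> poly_size (reveal_circ S) \<and>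
     (\<forall>lam. density_matrix (2 ^ advice_len S lam) (advice S lam) \<and>
        inputs (commit_circ S lam) = 2 * n_par lam * 2 ^ d_par lam + advice_len S lam \<and>
        outputs (commit_circ S lam) = msg_len S lam + inputs (reveal_circ S lam))"

definition commit_phase :: "sender \<Rightarrow> nat \<Rightarrow> (transcript \<times> complex mat) pmf" where
  "commit_phase S lam =
     do {
       P \<leftarrow> receiver_paulis lam;
       let \<sigma> = run (commit_circ S lam)
                 (tensor_mat (proj (ket (paulis_code lam P))) (advice S lam));
       msg \<leftarrow> measure_first (msg_len S lam) \<sigma>;
       return_pmf ((P, msg), post_state (msg_len S lam) \<sigma> msg)
     }"

text \<open>
  The receiver reads an opening as the key, i.e. the first \<open>lam\<close> bits, followed by the bit \<open>b\<close>; it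
  outputs \<open>None\<close> if what follows the key is not a single bit.
\<close>

definition receiver_output ::
  "(nat \<Rightarrow> nat \<Rightarrow> circuit) \<Rightarrow> (nat \<Rightarrow> circuit) \<Rightarrow> (nat \<Rightarrow> complex Matrix.vec) \<Rightarrow> nat \<Rightarrow>
   transcript \<Rightarrow> bool list \<Rightarrow> bool option pmf" where
  "receiver_output T Ghat abt lam \<tau> opening =
     (case drop lam opening of
        [b] \<Rightarrow>
          do {
            V \<leftarrow> Pi_pmf {x. length x = d_par lam} Invalid
                  (\<lambda>x. verify T Ghat abt lam (fst \<tau> x) (take lam opening) x b
                        (committed_mat lam (snd \<tau>) x));
            return_pmf (if \<forall>x. length x = d_par lam \<longrightarrow> V x = Valid then Some b else None)
          }
      | _ \<Rightarrow> return_pmf None)"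

definition reveal_phase ::
  "(nat \<Rightarrow> nat \<Rightarrow> circuit) \<Rightarrow> (nat \<Rightarrow> circuit) \<Rightarrow> (nat \<Rightarrow> complex Matrix.vec) \<Rightarrow>
   sender \<Rightarrow> nat \<Rightarrow> transcript \<Rightarrow> complex mat \<Rightarrow> bool option pmf" where
  "reveal_phase T Ghat abt S lam \<tau> \<sigma> =
     run_measure (reveal_circ S lam) \<sigma> \<bind> receiver_output T Ghat abt lam \<tau>"

definition binding_game ::
  "(nat \<Rightarrow> nat \<Rightarrow> circuit) \<Rightarrow> (nat \<Rightarrow> circuit) \<Rightarrow> (nat \<Rightarrow> complex Matrix.vec) \<Rightarrow>
   sender \<Rightarrow> (nat \<Rightarrow> transcript \<Rightarrow> bool pmf) \<Rightarrow> nat \<Rightarrow> (bool option \<times> bool) pmf" where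
  "binding_game T Ghat abt S E lam =
     do {
       (\<tau>, \<sigma>) \<leftarrow> commit_phase S lam;
       b \<leftarrow> E lam \<tau>;
       \<mu> \<leftarrow> reveal_phase T Ghat abt S lam \<tau> \<sigma>;
       return_pmf (\<mu>, b)
     }"

end

theory Submission
  imports Defs
begin

text \<open>
  A majority of Markov-good estimates makes each verification sound up to probability
  \<open>2 powr (- \<lambda> / 2)\<close>: unless the committed matrix is within \<open>7 / 60\<close> of the state
  \<open>Phi\<close> of the opening, it is rejected. If one matrix is that close to the states of two openings
  \<open>(k, 1)\<close> and \<open>(k', 0)\<close>, the abort test forces the weight of \<open>|\<psi>'\<rangle>\<close> in the second state to be
  large, hence \<open>|\<langle>\<psi>'|P|\<psi>\<rangle>|\<^sup>2 \<ge> 1 / 2\<close>; as the Pauli twirl of a pure state is maximally mixed,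
  a uniform \<open>P\<close> satisfies this with probability at most \<open>2 / 2 ^ n\<close>. These events are
  independent over the \<open>2 ^ d\<close> inputs and \<open>n * 2 ^ d \<ge> 3 * \<lambda>\<close>, so a union bound over the \<open>4 ^ \<lambda>\<close>
  pairs of keys shows that almost no choice of Pauli operators admits two openings.
\<close>

section \<open>Quadratic forms and the Frobenius norm\<close>

lemma mat_adjoint_index:
  assumes "A \<in> carrier_mat N N" "i < N" "j < N"
  shows "mat_adjoint A $$ (i, j) = cnj (A $$ (j, i))"
  using assms by (simp add: mat_adjoint_def mat_of_rows_def)

lemma mat_adjoint_eq_self_iff:
  fixes A :: "complex mat"
  assumes "A \<in> carrier_mat N N"
  shows "mat_adjoint A = A \<longleftrightarrow> (\<forall>i<N. \<forall>j<N. A $$ (i, j) = cnj (A $$ (j, i)))"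
proof
  assume A: "mat_adjoint A = A"
  show "\<forall>i<N. \<forall>j<N. A $$ (i, j) = cnj (A $$ (j, i))"
  proof (intro allI impI)
    fix i j assume "i < N" "j < N"
    from mat_adjoint_index[OF assms this] show "A $$ (i, j) = cnj (A $$ (j, i))"
      unfolding A .
  qed
next
  assume A: "\<forall>i<N. \<forall>j<N. A $$ (i, j) = cnj (A $$ (j, i))"
  show "mat_adjoint A = A"
  proof (rule eq_matI)
    fix i j assume "i < dim_row A" "j < dim_col A"
    then have "i < N" "j < N" using assms by auto
    then show "mat_adjoint A $$ (i, j) = A $$ (i, j)"
      using mat_adjoint_index[OF assms, of i j] A by metis
  qed (use assms in \<open>auto simp: mat_adjoint_def\<close>)
qed

lemma cscalar_prod_eq_sum:
  fixes u v :: "complex Matrix.vec"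
  assumes "v \<in> carrier_vec N"
  shows "u \<bullet>c v = (\<Sum>i<N. vec_index u i * cnj (vec_index v i))"
  using assms by (simp add: scalar_prod_def atLeast0LessThan)

lemma mult_mat_vec_index:
  fixes A :: "complex mat"
  assumes "A \<in> carrier_mat N N" "v \<in> carrier_vec N" "i < N"
  shows "vec_index (A *\<^sub>v v) i = (\<Sum>j<N. A $$ (i, j) * vec_index v j)"
  using assms by (simp add: scalar_prod_def atLeast0LessThan)

lemma mult_mat_index:
  fixes A B :: "complex mat"
  assumes "A \<in> carrier_mat N N" "B \<in> carrier_mat N N" "i < N" "j < N"
  shows "(A * B) $$ (i, j) = (\<Sum>k<N. A $$ (i, k) * B $$ (k, j))"
  using assms by (simp add: scalar_prod_def atLeast0LessThan)

text \<open>As \<open>\<bullet>c\<close> conjugates its second argument, this is <v|A|v>, whose real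
  part is what the positivity clause of \<open>density_matrix\<close> and the abort test of
  \<open>verify\<close> inspect.\<close>

definition qform :: "complex mat \<Rightarrow> complex Matrix.vec \<Rightarrow> complex" where
  "qform A v = (A *\<^sub>v v) \<bullet>c v"

lemma qform_eq_sum:
  assumes "A \<in> carrier_mat N N" "v \<in> carrier_vec N"
  shows "qform A v = (\<Sum>i<N. \<Sum>j<N. A $$ (i, j) * vec_index v j * cnj (vec_index v i))"
  unfolding qform_def cscalar_prod_eq_sum[OF assms(2)]
  by (intro sum.cong) (use assms in \<open>simp_all add: mult_mat_vec_index sum_distrib_right
    del: index_mult_mat_vec\<close>)

lemma qform_add:
  assumes "A \<in> carrier_mat N N" "B \<in> carrier_mat N N" "v \<in> carrier_vec N"
  shows "qform (A + B) v = qform A v + qform B v"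
  using assms by (simp add: qform_eq_sum[where N = N] distrib_right sum.distrib)

lemma qform_minus:
  assumes "A \<in> carrier_mat N N" "B \<in> carrier_mat N N" "v \<in> carrier_vec N"
  shows "qform (A - B) v = qform A v - qform B v"
  using assms by (simp add: qform_eq_sum[where N = N] left_diff_distrib sum_subtractf minus_carrier_mat)

lemma qform_smult:
  assumes "A \<in> carrier_mat N N" "v \<in> carrier_vec N"
  shows "qform (c \<cdot>\<^sub>m A) v = c * qform A v"
  using assms by (simp add: qform_eq_sum[where N = N] sum_distrib_left mult.assoc)

lemma proj_carrier [simp]: "v \<in> carrier_vec N \<Longrightarrow> proj v \<in> carrier_mat N N"
  by (auto simp: proj_def)

lemma qform_proj:
  assumes "w \<in> carrier_vec N" "v \<in> carrier_vec N"
  shows "qform (proj w) v = complex_of_real ((cmod (w \<bullet>c v))\<^sup>2)"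
proof -
  have "qform (proj w) v = (\<Sum>i<N. \<Sum>j<N. (vec_index w i * cnj (vec_index v i)) *
      cnj (vec_index w j * cnj (vec_index v j)))"
    unfolding qform_eq_sum[OF proj_carrier[OF assms(1)] assms(2)] using assms
    by (intro sum.cong) (auto simp: proj_def)
  also have "\<dots> = (w \<bullet>c v) * cnj (w \<bullet>c v)"
    unfolding cscalar_prod_eq_sum[OF assms(2)] cnj_sum sum_product ..
  finally show ?thesis
    by (simp only: complex_norm_square)
qed

text \<open>Minkowski and Cauchy-Schwarz for the Frobenius norm are inherited from
  \<open>L2_set\<close> through this flattening of index pairs.\<close>

lemma frob_norm_eq_L2_set:
  assumes "A \<in> carrier_mat N N"
  shows "frob_norm A = L2_set (\<lambda>(i, j). cmod (A $$ (i, j))) ({..<N} \<times> {..<N})"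
  using assms by (auto simp: frob_norm_def L2_set_def sum.cartesian_product split_def)

lemma frob_norm_minus_commute:
  assumes "A \<in> carrier_mat N N" "B \<in> carrier_mat N N"
  shows "frob_norm (A - B) = frob_norm (B - A)"
  using assms by (auto simp: frob_norm_def norm_minus_commute intro!: sum.cong)

lemma frob_norm_triangle:
  assumes "A \<in> carrier_mat N N" "B \<in> carrier_mat N N" "C \<in> carrier_mat N N"
  shows "frob_norm (A - C) \<le> frob_norm (A - B) + frob_norm (B - C)"
proof -
  let ?I = "{..<N} \<times> {..<N}"
  let ?f = "\<lambda>M p. case p of (i, j) \<Rightarrow> cmod ((M :: complex mat) $$ (i, j))"
  have "L2_set (?f (A - C)) ?I \<le> L2_set (\<lambda>p. ?f (A - B) p + ?f (B - C) p) ?I"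
  proof (rule L2_set_mono)
    fix p assume "p \<in> ?I"
    then obtain i j where p: "p = (i, j)" "i < N" "j < N" by auto
    have "cmod (A $$ p - C $$ p) \<le> cmod (A $$ p - B $$ p) + cmod (B $$ p - C $$ p)"
      by (rule norm_triangle_sub[of "A $$ p - C $$ p" "A $$ p - B $$ p", simplified])
    then show "?f (A - C) p \<le> ?f (A - B) p + ?f (B - C) p"
      using assms p by simp
  qed auto
  also have "\<dots> \<le> L2_set (?f (A - B)) ?I + L2_set (?f (B - C)) ?I"
    by (rule L2_set_triangle_ineq)
  finally show ?thesis
    unfolding frob_norm_eq_L2_set[OF minus_carrier_mat[OF assms(2)]] frob_norm_eq_L2_set[OF minus_carrier_mat[OF assms(3)]] .
qed

text \<open><v|A|v> is the Hilbert-Schmidt inner product of A with |v><v|, which has Frobenius norm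
  1, so Cauchy-Schwarz applies. Frobenius closeness of two matrices thus becomes closeness of their
  expectations in any unit vector.\<close>

lemma cmod_qform_le:
  assumes "A \<in> carrier_mat N N" "v \<in> carrier_vec N" "(\<Sum>i<N. (cmod (vec_index v i))\<^sup>2) = 1"
  shows "cmod (qform A v) \<le> frob_norm A"
proof -
  let ?I = "{..<N} \<times> {..<N}"
  let ?a = "\<lambda>(i, j). cmod (A $$ (i, j))"
  let ?v = "\<lambda>(i, j). cmod (vec_index v j) * cmod (vec_index v i)"
  have "L2_set ?v ?I = sqrt ((\<Sum>i<N. (cmod (vec_index v i))\<^sup>2) * (\<Sum>i<N. (cmod (vec_index v i))\<^sup>2))"
    unfolding L2_set_def sum_product sum.cartesian_product
    by (intro arg_cong[where f = sqrt] sum.cong) (auto simp: power_mult_distrib)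
  then have v: "L2_set ?v ?I = 1"
    using assms(3) by simp
  have "cmod (qform A v) \<le> (\<Sum>p\<in>?I. \<bar>?a p\<bar> * \<bar>?v p\<bar>)"
    unfolding qform_eq_sum[OF assms(1,2)] sum.cartesian_product
    by (rule sum_norm_le) (auto simp: norm_mult)
  also have "\<dots> \<le> L2_set ?a ?I * L2_set ?v ?I"
    by (rule L2_set_mult_ineq)
  finally show ?thesis
    using v frob_norm_eq_L2_set[OF assms(1)] by simp
qed

section \<open>Tensor products and Pauli operators\<close>

text \<open>An index of a tensor product is a pair recovered by \<open>div\<close> and
  \<open>mod\<close>; this reindexing lets sums over such indices factor.\<close>

lemma sum_div_mod:
  fixes f :: "nat \<Rightarrow> nat \<Rightarrow> 'a :: comm_monoid_add"
  assumes "b > 0"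
  shows "(\<Sum>i<a * b. f (i div b) (i mod b)) = (\<Sum>i<a. \<Sum>j<b. f i j)"
  unfolding sum.cartesian_product
proof (rule sum.reindex_bij_witness[where i = "\<lambda>(i, j). i * b + j" and j = "\<lambda>k. (k div b, k mod b)"])
  fix p assume "p \<in> {..<a} \<times> {..<b}"
  then obtain i j where p: "p = (i, j)" "i < a" "j < b" by auto
  have "i * b + j < (i + 1) * b" using p by simp
  also have "\<dots> \<le> a * b" using p by (intro mult_right_mono) auto
  finally show "(case p of (i, j) \<Rightarrow> i * b + j) \<in> {..<a * b}" using p by simp
qed (use assms in \<open>auto simp: less_mult_imp_div_less\<close>)

lemma div_less_and_mod_less:
  fixes i a b :: nat
  assumes "i < a * b"
  shows "i div b < a" "i mod b < b"
  using assms less_mult_imp_div_less by (auto intro!: mod_less_divisor gr0I)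

lemma eq_iff_div_eq_mod_eq:
  fixes i j b :: nat
  shows "i = j \<longleftrightarrow> i div b = j div b \<and> i mod b = j mod b"
  by (metis div_mult_mod_eq)

lemma tensor_vec_carrier [intro]:
  "u \<in> carrier_vec a \<Longrightarrow> v \<in> carrier_vec b \<Longrightarrow> tensor_vec u v \<in> carrier_vec (a * b)"
  by (auto simp: tensor_vec_def)

lemma tensor_mat_carrier [intro]:
  "A \<in> carrier_mat a a \<Longrightarrow> B \<in> carrier_mat b b \<Longrightarrow> tensor_mat A B \<in> carrier_mat (a * b) (a * b)"
  by (auto simp: tensor_mat_def)

lemma tensor_mat_index:
  assumes "A \<in> carrier_mat a a" "B \<in> carrier_mat b b" "i < a * b" "j < a * b"
  shows "tensor_mat A B $$ (i, j) = A $$ (i div b, j div b) * B $$ (i mod b, j mod b)"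
  using assms by (auto simp: tensor_mat_def)

lemma tensor_vec_index:
  assumes "u \<in> carrier_vec a" "v \<in> carrier_vec b" "i < a * b"
  shows "vec_index (tensor_vec u v) i = vec_index u (i div b) * vec_index v (i mod b)"
  using assms by (auto simp: tensor_vec_def)

lemma cscalar_prod_tensor_vec:
  assumes "u \<in> carrier_vec a" "v \<in> carrier_vec b" "u' \<in> carrier_vec a" "v' \<in> carrier_vec b" "b > 0"
  shows "tensor_vec u v \<bullet>c tensor_vec u' v' = (u \<bullet>c u') * (v \<bullet>c v')"
proof -
  have "tensor_vec u v \<bullet>c tensor_vec u' v' = (\<Sum>i<a * b.
      (vec_index u (i div b) * cnj (vec_index u' (i div b)))
        * (vec_index v (i mod b) * cnj (vec_index v' (i mod b))))"
    unfolding cscalar_prod_eq_sum[OF tensor_vec_carrier[OF assms(3,4)]]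
    by (intro sum.cong) (auto simp: tensor_vec_index[OF assms(1,2)] tensor_vec_index[OF assms(3,4)])
  also have "\<dots> = (u \<bullet>c u') * (v \<bullet>c v')"
    using sum_div_mod[OF assms(5), where f = "\<lambda>i j. (vec_index u i * cnj (vec_index u' i))
        * (vec_index v j * cnj (vec_index v' j))" and a = a]
    by (simp add: cscalar_prod_eq_sum[OF assms(3)] cscalar_prod_eq_sum[OF assms(4)] sum_product)
  finally show ?thesis .
qed

lemma tensor_mat_proj:
  assumes "u \<in> carrier_vec a" "v \<in> carrier_vec b"
  shows "tensor_mat (proj u) (proj v) = proj (tensor_vec u v)"
  using assms by (intro eq_matI)
    (auto simp: tensor_mat_def tensor_vec_def proj_def div_less_and_mod_less)

lemma tensor_mat_mult_vec:
  assumes "A \<in> carrier_mat a a" "B \<in> carrier_mat b b" "u \<in> carrier_vec a" "v \<in> carrier_vec b"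
  shows "tensor_mat A B *\<^sub>v tensor_vec u v = tensor_vec (A *\<^sub>v u) (B *\<^sub>v v)"
proof (rule eq_vecI)
  have Au: "A *\<^sub>v u \<in> carrier_vec a" and Bv: "B *\<^sub>v v \<in> carrier_vec b"
    using assms by auto
  show "dim_vec (tensor_mat A B *\<^sub>v tensor_vec u v) = dim_vec (tensor_vec (A *\<^sub>v u) (B *\<^sub>v v))"
    using assms by (simp add: tensor_mat_def tensor_vec_def)
  fix i assume "i < dim_vec (tensor_vec (A *\<^sub>v u) (B *\<^sub>v v))"
  then have i: "i < a * b" using assms by (simp add: tensor_vec_def)
  then have b: "b > 0" by (auto intro: gr0I)
  have "vec_index (tensor_mat A B *\<^sub>v tensor_vec u v) i = (\<Sum>j<a * b.
      (A $$ (i div b, j div b) * vec_index u (j div b))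
        * (B $$ (i mod b, j mod b) * vec_index v (j mod b)))"
    unfolding mult_mat_vec_index[OF tensor_mat_carrier[OF assms(1,2)] tensor_vec_carrier[OF assms(3,4)] i]
    by (intro sum.cong) (auto simp: tensor_vec_index[OF assms(3,4)] tensor_mat_index[OF assms(1,2) i])
  also have "\<dots> = (\<Sum>j<a. \<Sum>l<b.
      (A $$ (i div b, j) * vec_index u j) * (B $$ (i mod b, l) * vec_index v l))"
    by (rule sum_div_mod[OF b])
  also have "\<dots> = vec_index (A *\<^sub>v u) (i div b) * vec_index (B *\<^sub>v v) (i mod b)"
    using div_less_and_mod_less[OF i] assms
    by (simp only: mult_mat_vec_index[OF assms(1,3)] mult_mat_vec_index[OF assms(2,4)] sum_product)
  finally show "vec_index (tensor_mat A B *\<^sub>v tensor_vec u v) i =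
      vec_index (tensor_vec (A *\<^sub>v u) (B *\<^sub>v v)) i"
    by (simp only: tensor_vec_index[OF Au Bv i])
qed

text \<open>Spelled out on entries because that is the form in which the sums below are rearranged.
  Such an \<open>R\<close> is unitary and its own adjoint, so multiplying by the same matrix on both
  sides, as in \<open>Phi\<close>, is a unitary conjugation.\<close>

definition hermitian_involution :: "nat \<Rightarrow> complex mat \<Rightarrow> bool" where
  "hermitian_involution N R \<longleftrightarrow> R \<in> carrier_mat N N \<and>
     (\<forall>i<N. \<forall>j<N. R $$ (i, j) = cnj (R $$ (j, i))) \<and>
     (\<forall>i<N. \<forall>j<N. (\<Sum>k<N. R $$ (i, k) * R $$ (k, j)) = of_bool (i = j))"

lemma hermitian_involutionD:
  assumes "hermitian_involution N R"
  shows "R \<in> carrier_mat N N"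
    and "i < N \<Longrightarrow> j < N \<Longrightarrow> R $$ (i, j) = cnj (R $$ (j, i))"
    and "i < N \<Longrightarrow> j < N \<Longrightarrow> (\<Sum>k<N. R $$ (i, k) * R $$ (k, j)) = of_bool (i = j)"
  using assms unfolding hermitian_involution_def by blast+

lemma hermitian_involution_one: "hermitian_involution N (1\<^sub>m N)"
proof -
  have "(\<Sum>k<N. 1\<^sub>m N $$ (i, k) * 1\<^sub>m N $$ (k, j)) = (of_bool (i = j) :: complex)"
    if "i < N" "j < N" for i j
  proof -
    have "(\<Sum>k<N. 1\<^sub>m N $$ (i, k) * 1\<^sub>m N $$ (k, j)) = (\<Sum>k<N. if k = i then of_bool (i = j) else (0::complex))"
      using that by (intro sum.cong) auto
    then show ?thesis using that by simp
  qed
  then show ?thesis by (auto simp: hermitian_involution_def)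
qed

lemma hermitian_involution_tensor:
  assumes "hermitian_involution a A" "hermitian_involution b B"
  shows "hermitian_involution (a * b) (tensor_mat A B)"
  unfolding hermitian_involution_def
proof (intro conjI allI impI)
  have A: "A \<in> carrier_mat a a" and B: "B \<in> carrier_mat b b"
    using assms by (blast dest: hermitian_involutionD(1))+
  show "tensor_mat A B \<in> carrier_mat (a * b) (a * b)" using A B by auto
  fix i j assume ij: "i < a * b" "j < a * b"
  then have b: "b > 0" by (auto intro: gr0I)
  note bounds = div_less_and_mod_less[OF ij(1)] div_less_and_mod_less[OF ij(2)]
  have "A $$ (i div b, j div b) = cnj (A $$ (j div b, i div b))"
    "B $$ (i mod b, j mod b) = cnj (B $$ (j mod b, i mod b))"
    using hermitian_involutionD(2)[OF assms(1)] hermitian_involutionD(2)[OF assms(2)] bounds by blast+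
  then show "tensor_mat A B $$ (i, j) = cnj (tensor_mat A B $$ (j, i))"
    using ij by (simp only: tensor_mat_index[OF A B] complex_cnj_mult)
  have "(\<Sum>k<a * b. tensor_mat A B $$ (i, k) * tensor_mat A B $$ (k, j)) =
      (\<Sum>k<a * b. (A $$ (i div b, k div b) * A $$ (k div b, j div b))
        * (B $$ (i mod b, k mod b) * B $$ (k mod b, j mod b)))"
    using ij by (intro sum.cong) (auto simp: tensor_mat_index[OF A B])
  also have "\<dots> = (\<Sum>k<a. A $$ (i div b, k) * A $$ (k, j div b))
        * (\<Sum>l<b. B $$ (i mod b, l) * B $$ (l, j mod b))"
    unfolding sum_product by (rule sum_div_mod[OF b])
  also have "\<dots> = of_bool (i div b = j div b) * of_bool (i mod b = j mod b)"
    by (simp only: hermitian_involutionD(3)[OF assms(1)] hermitian_involutionD(3)[OF assms(2)] bounds)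
  also have "\<dots> = of_bool (i = j)"
    using eq_iff_div_eq_mod_eq[of i j b] by simp
  finally show "(\<Sum>k<a * b. tensor_mat A B $$ (i, k) * tensor_mat A B $$ (k, j)) = of_bool (i = j)" .
qed

text \<open>\<open>R\<close> is an isometry because its adjoint is \<open>R\<close> and its square
  is the identity; once the sums are exchanged, the innermost one is an entry of this
  square.\<close>

lemma hermitian_involution_cscalar_prod:
  assumes R: "hermitian_involution N R" and v: "v \<in> carrier_vec N"
  shows "(R *\<^sub>v v) \<bullet>c (R *\<^sub>v v) = v \<bullet>c v"
proof -
  have Rc: "R \<in> carrier_mat N N" using R by (rule hermitian_involutionD(1))
  then have Rv: "R *\<^sub>v v \<in> carrier_vec N" using v by auto
  have "(R *\<^sub>v v) \<bullet>c (R *\<^sub>v v) = (\<Sum>i<N. \<Sum>j<N. \<Sum>k<N.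
      (R $$ (i, j) * vec_index v j) * cnj (R $$ (i, k) * vec_index v k))"
    unfolding cscalar_prod_eq_sum[OF Rv]
    by (intro sum.cong refl) (auto simp only: mult_mat_vec_index[OF Rc v] lessThan_iff cnj_sum sum_product)
  also have "\<dots> = (\<Sum>i<N. \<Sum>j<N. \<Sum>k<N.
      vec_index v j * cnj (vec_index v k) * (R $$ (k, i) * R $$ (i, j)))"
  proof (intro sum.cong refl)
    fix i j k assume "i \<in> {..<N}" "k \<in> {..<N}"
    then have "R $$ (k, i) = cnj (R $$ (i, k))" using hermitian_involutionD(2)[OF R] by blast
    then show "(R $$ (i, j) * vec_index v j) * cnj (R $$ (i, k) * vec_index v k) =
        vec_index v j * cnj (vec_index v k) * (R $$ (k, i) * R $$ (i, j))"
      by (simp only: complex_cnj_mult mult_ac)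
  qed
  also have "\<dots> = (\<Sum>j<N. \<Sum>k<N. \<Sum>i<N.
      vec_index v j * cnj (vec_index v k) * (R $$ (k, i) * R $$ (i, j)))"
    by (rule trans[OF sum.swap]) (intro sum.cong refl sum.swap)
  also have "\<dots> = (\<Sum>j<N. \<Sum>k<N. vec_index v j * cnj (vec_index v k) * of_bool (k = j))"
    unfolding sum_distrib_left[symmetric]
    by (intro sum.cong refl) (simp add: hermitian_involutionD(3)[OF R])
  also have "\<dots> = (\<Sum>j<N. \<Sum>k<N. if k = j then vec_index v j * cnj (vec_index v j) else 0)"
    by (intro sum.cong refl) auto
  also have "\<dots> = v \<bullet>c v"
    unfolding cscalar_prod_eq_sum[OF v] by (intro sum.cong refl) auto
  finally show ?thesis .
qed

text \<open>Multiplication on the right acts on the bra of |v><v|, and Hermiticity turns this into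
  the conjugate of the action on the ket.\<close>

lemma hermitian_involution_conjugate_proj:
  assumes R: "hermitian_involution N R" and v: "v \<in> carrier_vec N"
  shows "R * proj v * R = proj (R *\<^sub>v v)"
proof (rule eq_matI)
  have Rc: "R \<in> carrier_mat N N" using R by (rule hermitian_involutionD(1))
  have Rv: "R *\<^sub>v v \<in> carrier_vec N" using Rc v by auto
  fix i j assume "i < dim_row (proj (R *\<^sub>v v))" "j < dim_col (proj (R *\<^sub>v v))"
  then have ij: "i < N" "j < N" using Rc by (auto simp: proj_def)
  have "(R * proj v * R) $$ (i, j) = (\<Sum>k<N. (R * proj v) $$ (i, k) * R $$ (k, j))"
    by (rule mult_mat_index) (use Rc v ij in auto)
  also have "\<dots> = (\<Sum>k<N. \<Sum>l<N. (R $$ (i, l) * vec_index v l) * cnj (R $$ (j, k) * vec_index v k))"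
  proof (intro sum.cong refl)
    fix k assume k: "k \<in> {..<N}"
    have "(R * proj v) $$ (i, k) = (\<Sum>l<N. R $$ (i, l) * proj v $$ (l, k))"
      by (rule mult_mat_index) (use Rc v ij k in auto)
    also have "\<dots> = (\<Sum>l<N. R $$ (i, l) * vec_index v l * cnj (vec_index v k))"
      using v k by (intro sum.cong refl) (auto simp: proj_def)
    finally have "(R * proj v) $$ (i, k) = (\<Sum>l<N. R $$ (i, l) * vec_index v l * cnj (vec_index v k))" .
    moreover have "R $$ (k, j) = cnj (R $$ (j, k))"
      using hermitian_involutionD(2)[OF R] k ij by blast
    ultimately show "(R * proj v) $$ (i, k) * R $$ (k, j) =
        (\<Sum>l<N. (R $$ (i, l) * vec_index v l) * cnj (R $$ (j, k) * vec_index v k))"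
      by (simp add: sum_distrib_left sum_distrib_right mult_ac)
  qed
  also have "\<dots> = vec_index (R *\<^sub>v v) i * cnj (vec_index (R *\<^sub>v v) j)"
    unfolding mult_mat_vec_index[OF Rc v ij(1)] mult_mat_vec_index[OF Rc v ij(2)] cnj_sum sum_product
    by (rule sum.swap)
  finally show "(R * proj v * R) $$ (i, j) = proj (R *\<^sub>v v) $$ (i, j)"
    using ij Rc by (simp add: proj_def del: index_mult_mat_vec)
qed (use hermitian_involutionD(1)[OF R] in \<open>auto simp: proj_def\<close>)

section \<open>Pauli operators: completeness relation and twirl\<close>

lemma less_2_iff_0_or_1: "(i :: nat) < 2 \<longleftrightarrow> i = 0 \<or> i = 1"
  by auto

lemma pauli1_carrier: "pauli1 a \<in> carrier_mat 2 2"
  by (cases a) (auto simp: mat_of_rows_list_def)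

lemma hermitian_involution_pauli1: "hermitian_involution 2 (pauli1 a)"
  using pauli1_carrier[of a]
  by (cases a) (auto simp: hermitian_involution_def mat_of_rows_list_def less_2_iff_0_or_1 numeral_2_eq_2 less_Suc_eq)

lemma pauli_mat_Cons: "pauli_mat (a # p) = tensor_mat (pauli1 a) (pauli_mat p)"
  by (simp add: pauli_mat_def tensor_list_def)

lemma hermitian_involution_pauli_mat: "hermitian_involution (2 ^ length p) (pauli_mat p)"
proof (induction p)
  case Nil
  then show ?case using hermitian_involution_one[of 1] by (simp add: pauli_mat_def tensor_list_def)
next
  case (Cons a p)
  then show ?case
    using hermitian_involution_tensor[OF hermitian_involution_pauli1 Cons] by (simp add: pauli_mat_Cons)
qed

lemma pauli_mat_carrier: "pauli_mat p \<in> carrier_mat (2 ^ length p) (2 ^ length p)"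
  using hermitian_involution_pauli_mat by (rule hermitian_involutionD(1))

lemma UNIV_pauli: "UNIV = {PauliI, PauliX, PauliY, PauliZ}"
  using pauli.exhaust by auto

instance pauli :: finite
  by standard (simp add: UNIV_pauli)

lemma CARD_pauli: "CARD(pauli) = 4"
  by (simp add: UNIV_pauli)

lemma pauli1_entries:
  "pauli1 PauliI $$ (0, 0) = 1" "pauli1 PauliI $$ (0, 1) = 0" "pauli1 PauliI $$ (1, 0) = 0" "pauli1 PauliI $$ (1, 1) = 1"
  "pauli1 PauliX $$ (0, 0) = 0" "pauli1 PauliX $$ (0, 1) = 1" "pauli1 PauliX $$ (1, 0) = 1" "pauli1 PauliX $$ (1, 1) = 0"
  "pauli1 PauliY $$ (0, 0) = 0" "pauli1 PauliY $$ (0, 1) = - \<i>" "pauli1 PauliY $$ (1, 0) = \<i>" "pauli1 PauliY $$ (1, 1) = 0"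
  "pauli1 PauliZ $$ (0, 0) = 1" "pauli1 PauliZ $$ (0, 1) = 0" "pauli1 PauliZ $$ (1, 0) = 0" "pauli1 PauliZ $$ (1, 1) = -1"
  by (simp_all add: mat_of_rows_list_def)

text \<open>The Pauli matrices are an orthogonal basis of the 2 by 2 matrices. Summing over the
  operators instead of the entries gives the completeness relation; 2 is the squared Frobenius norm
  of each operator.\<close>

lemma pauli1_orthogonality:
  assumes "i < 2" "j < 2" "k < 2" "l < 2"
  shows "(\<Sum>a\<in>UNIV. pauli1 a $$ (i, j) * cnj (pauli1 a $$ (k, l))) = 2 * of_bool (i = k \<and> j = l)"
proof -
  have "i = 0 \<or> i = 1" "j = 0 \<or> j = 1" "k = 0 \<or> k = 1" "l = 0 \<or> l = 1" using assms by auto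
  then show ?thesis
    by (elim disjE) (simp_all add: UNIV_pauli pauli1_entries del: One_nat_def pauli1.simps)
qed

lemma lists_of_length_Suc: "{p. length p = Suc n} = (\<lambda>(a, p). a # p) ` (UNIV \<times> {p. length p = n})"
  by (auto simp: length_Suc_conv)

lemma finite_lists_of_length: "finite {p :: 'a :: finite list. length p = n}"
  using finite_lists_length_eq[of "UNIV :: 'a set" n] by simp

lemma card_lists_of_length: "card {p :: 'a :: finite list. length p = n} = CARD('a) ^ n"
  using card_lists_length_eq[of "UNIV :: 'a set" n] by simp

text \<open>The sum over strings splits into one over the first letter and one over the rest, while
  \<open>div\<close> and \<open>mod\<close> split the indices, so each letter contributes a factor
  2.\<close>

lemma pauli_mat_orthogonality:
  assumes "i < 2 ^ n" "j < 2 ^ n" "k < 2 ^ n" "l < 2 ^ n"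
  shows "(\<Sum>p | length p = n. pauli_mat p $$ (i, j) * cnj (pauli_mat p $$ (k, l))) =
    2 ^ n * of_bool (i = k \<and> j = l)"
  using assms
proof (induction n arbitrary: i j k l)
  case 0
  then show ?case by (simp add: pauli_mat_def tensor_list_def)
next
  case (Suc n)
  let ?m = "2 ^ n :: nat"
  have b: "i < 2 * ?m" "j < 2 * ?m" "k < 2 * ?m" "l < 2 * ?m" using Suc.prems by auto
  have "(\<Sum>p | length p = Suc n. pauli_mat p $$ (i, j) * cnj (pauli_mat p $$ (k, l))) =
    (\<Sum>(a, p)\<in>UNIV \<times> {p. length p = n}.
      pauli_mat (a # p) $$ (i, j) * cnj (pauli_mat (a # p) $$ (k, l)))"
    unfolding lists_of_length_Suc by (subst sum.reindex) (auto simp: inj_on_def split_def)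
  also have "\<dots> = (\<Sum>(a, p)\<in>UNIV \<times> {p. length p = n}.
      (pauli1 a $$ (i div ?m, j div ?m) * cnj (pauli1 a $$ (k div ?m, l div ?m))) *
      (pauli_mat p $$ (i mod ?m, j mod ?m) * cnj (pauli_mat p $$ (k mod ?m, l mod ?m))))"
    by (intro sum.cong refl)
      (use b in \<open>auto simp: pauli_mat_Cons tensor_mat_index[OF pauli1_carrier pauli_mat_carrier]\<close>)
  also have "\<dots> = (\<Sum>a\<in>UNIV. pauli1 a $$ (i div ?m, j div ?m) * cnj (pauli1 a $$ (k div ?m, l div ?m))) *
      (\<Sum>p | length p = n. pauli_mat p $$ (i mod ?m, j mod ?m) * cnj (pauli_mat p $$ (k mod ?m, l mod ?m)))"
    unfolding sum_product sum.cartesian_product ..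
  also have "\<dots> = (2 * of_bool (i div ?m = k div ?m \<and> j div ?m = l div ?m)) *
      (2 ^ n * of_bool (i mod ?m = k mod ?m \<and> j mod ?m = l mod ?m))"
    by (intro arg_cong2[where f = "(*)"] pauli1_orthogonality Suc.IH b[THEN div_less_and_mod_less(1)]
      b[THEN div_less_and_mod_less(2)])
  also have "\<dots> = 2 ^ Suc n * of_bool (i = k \<and> j = l)"
    using eq_iff_div_eq_mod_eq[of i k ?m] eq_iff_div_eq_mod_eq[of j l ?m] by simp
  finally show ?case .
qed

text \<open>The Pauli twirl: summed over all p, P|v><v|P is 2 ^ n times the squared norm of v times
  the identity. Its expectation in u is the right-hand side.\<close>

lemma sum_pauli_mat_overlap:
  assumes "u \<in> carrier_vec (2 ^ n)" "v \<in> carrier_vec (2 ^ n)"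
  shows "(\<Sum>p | length p = n. (cmod ((pauli_mat p *\<^sub>v v) \<bullet>c u))\<^sup>2) =
    2 ^ n * (\<Sum>i<2 ^ n. (cmod (vec_index u i))\<^sup>2) * (\<Sum>i<2 ^ n. (cmod (vec_index v i))\<^sup>2)"
proof -
  let ?N = "2 ^ n :: nat" and ?L = "{p :: pauli list. length p = n}"
  let ?I = "{..<?N} \<times> {..<?N}"
  let ?w = "\<lambda>(i, j). vec_index v j * cnj (vec_index u i)"
  let ?P = "\<lambda>p q. pauli_mat p $$ q"
  \<comment> \<open>With \<open>?w\<close> collecting the vector entries, the squared overlap is a
    double sum over matrix positions in which only \<open>?P p q * cnj (?P p r)\<close> depends on
    p.\<close>
  have ov: "complex_of_real ((cmod ((pauli_mat p *\<^sub>v v) \<bullet>c u))\<^sup>2) =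
      (\<Sum>q\<in>?I. \<Sum>r\<in>?I. (?w q * cnj (?w r)) * (?P p q * cnj (?P p r)))" if "p \<in> ?L" for p
  proof -
    have Pc: "pauli_mat p \<in> carrier_mat ?N ?N" using pauli_mat_carrier[of p] that by simp
    have "(pauli_mat p *\<^sub>v v) \<bullet>c u = (\<Sum>i<?N. \<Sum>j<?N. ?P p (i, j) * ?w (i, j))"
      unfolding cscalar_prod_eq_sum[OF assms(1)]
      by (intro sum.cong refl) (auto simp: mult_mat_vec_index[OF Pc assms(2)] sum_distrib_right mult.assoc
        simp del: index_mult_mat_vec)
    then have *: "(pauli_mat p *\<^sub>v v) \<bullet>c u = (\<Sum>q\<in>?I. ?P p q * ?w q)"
      by (simp add: sum.cartesian_product split_def)
    show ?thesis
      unfolding complex_norm_square * cnj_sum sum_product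
      by (intro sum.cong refl) (simp only: complex_cnj_mult mult_ac)
  qed
  have "complex_of_real (\<Sum>p\<in>?L. (cmod ((pauli_mat p *\<^sub>v v) \<bullet>c u))\<^sup>2) =
      (\<Sum>p\<in>?L. \<Sum>q\<in>?I. \<Sum>r\<in>?I. (?w q * cnj (?w r)) * (?P p q * cnj (?P p r)))"
    unfolding of_real_sum by (intro sum.cong refl ov)
  also have "\<dots> = (\<Sum>q\<in>?I. \<Sum>r\<in>?I. (?w q * cnj (?w r)) * (\<Sum>p\<in>?L. ?P p q * cnj (?P p r)))"
    unfolding sum_distrib_left by (rule trans[OF sum.swap]) (intro sum.cong refl sum.swap)
  \<comment> \<open>Completeness keeps only equal positions.\<close>
  also have "\<dots> = (\<Sum>q\<in>?I. \<Sum>r\<in>?I. if r = q then ?w q * cnj (?w q) * ?N else 0)"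
    by (intro sum.cong refl) (auto simp: pauli_mat_orthogonality)
  also have "\<dots> = (\<Sum>q\<in>?I. ?w q * cnj (?w q) * ?N)"
    by (intro sum.cong refl) (subst sum.delta, auto)
  also have "\<dots> = complex_of_real (\<Sum>(i, j)\<in>?I. ?N * ((cmod (vec_index u i))\<^sup>2 * (cmod (vec_index v j))\<^sup>2))"
    unfolding of_real_sum
    by (intro sum.cong refl) (auto simp: complex_norm_square[unfolded of_real_power] mult_ac)
  finally have "(\<Sum>p\<in>?L. (cmod ((pauli_mat p *\<^sub>v v) \<bullet>c u))\<^sup>2) =
      (\<Sum>(i, j)\<in>?I. ?N * ((cmod (vec_index u i))\<^sup>2 * (cmod (vec_index v j))\<^sup>2))"
    by (simp only: of_real_eq_iff)
  also have "\<dots> = ?N * ((\<Sum>i<?N. (cmod (vec_index u i))\<^sup>2) * (\<Sum>i<?N. (cmod (vec_index v i))\<^sup>2))"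
    unfolding sum_product sum.cartesian_product by (simp add: sum_distrib_left split_def)
  finally show ?thesis by (simp add: mult.assoc)
qed

section \<open>Flagged states\<close>

lemma ket_carrier [simp]: "ket bs \<in> carrier_vec (2 ^ length bs)"
  by (simp add: ket_def)

lemma nat_of_bits_single: "nat_of_bits [b] = of_bool b"
  by (simp add: nat_of_bits_def)

lemma ket_single_cscalar_prod: "ket [a] \<bullet>c ket [b] = of_bool (a = b)"
proof -
  have "ket [b] \<in> carrier_vec 2" using ket_carrier[of "[b]"] by simp
  from cscalar_prod_eq_sum[OF this, of "ket [a]"] show ?thesis
    by (cases a; cases b) (simp_all add: ket_def nat_of_bits_single numeral_2_eq_2)
qed

lemma pure_state_iff: "pure_state q v \<longleftrightarrow> v \<in> carrier_vec (2 ^ q) \<and> v \<bullet>c v = 1"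
proof -
  have "v \<bullet>c v = complex_of_real (\<Sum>i<2 ^ q. (cmod (vec_index v i))\<^sup>2)" if "v \<in> carrier_vec (2 ^ q)"
    unfolding cscalar_prod_eq_sum[OF that] of_real_sum complex_norm_square ..
  then show ?thesis unfolding pure_state_def using of_real_eq_1_iff by metis
qed

lemma pure_state_flagged:
  assumes "pure_state q v"
  shows "pure_state (Suc q) (tensor_vec (ket [b]) v)"
proof -
  have "ket [b] \<in> carrier_vec 2" using ket_carrier[of "[b]"] by simp
  then show ?thesis
    using assms tensor_vec_carrier[of "ket [b]" 2 v "2 ^ q"]
    by (simp add: pure_state_iff cscalar_prod_tensor_vec[where a = 2 and b = "2 ^ q"] ket_single_cscalar_prod)
qed

text \<open>Different flags are orthogonal, which separates the abort component of a state from the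
  other one in the expectations below.\<close>

lemma cscalar_prod_flagged:
  assumes "pure_state q v" "pure_state q w"
  shows "tensor_vec (ket [a]) v \<bullet>c tensor_vec (ket [b]) w = of_bool (a = b) * (v \<bullet>c w)"
proof -
  have "ket [a] \<in> carrier_vec 2" "ket [b] \<in> carrier_vec 2"
    using ket_carrier[of "[a]"] ket_carrier[of "[b]"] by simp_all
  then show ?thesis using assms
    by (simp add: pure_state_iff cscalar_prod_tensor_vec[where a = 2 and b = "2 ^ q"] ket_single_cscalar_prod)
qed

lemma density_matrix_mixture:
  assumes "pure_state q u" "pure_state q w" "0 \<le> \<eta>" "\<eta> \<le> 1"
  shows "density_matrix (2 ^ q) (complex_of_real \<eta> \<cdot>\<^sub>m proj u + complex_of_real (1 - \<eta>) \<cdot>\<^sub>m proj w)"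
    (is "density_matrix ?N ?A")
proof -
  have uw: "u \<in> carrier_vec ?N" "w \<in> carrier_vec ?N"
    using assms by (auto simp: pure_state_def)
  have A: "?A \<in> carrier_mat ?N ?N" using uw by auto
  have entry: "?A $$ (i, j) = \<eta> * (vec_index u i * cnj (vec_index u j))
      + (1 - \<eta>) * (vec_index w i * cnj (vec_index w j))" if "i < ?N" "j < ?N" for i j
    using that uw by (auto simp: proj_def)
  have "?A $$ (i, j) = cnj (?A $$ (j, i))" if "i < ?N" "j < ?N" for i j
    unfolding entry[OF that] entry[OF that(2,1)] by (simp add: mult_ac)
  then have "mat_adjoint ?A = ?A"
    unfolding mat_adjoint_eq_self_iff[OF A] by blast
  moreover have "0 \<le> Re ((?A *\<^sub>v v) \<bullet>c v)" if v: "v \<in> carrier_vec ?N" for v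
  proof -
    have "qform ?A v = complex_of_real (\<eta> * (cmod (u \<bullet>c v))\<^sup>2 + (1 - \<eta>) * (cmod (w \<bullet>c v))\<^sup>2)"
      using uw v by (simp add: qform_add[where N = ?N] qform_smult[where N = ?N] qform_proj[where N = ?N])
    then show ?thesis using assms by (simp add: qform_def)
  qed
  moreover have "(\<Sum>i<?N. ?A $$ (i, i)) = 1"
  proof -
    have "(\<Sum>i<?N. ?A $$ (i, i)) = \<eta> * (u \<bullet>c u) + (1 - \<eta>) * (w \<bullet>c w)"
      unfolding cscalar_prod_eq_sum[OF uw(1)] cscalar_prod_eq_sum[OF uw(2)] sum_distrib_left
        sum.distrib[symmetric]
      by (intro sum.cong refl entry) auto
    then show ?thesis using assms by (simp add: pure_state_iff)
  qed
  ultimately show ?thesis using A by (simp add: density_matrix_def)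
qed

text \<open>\<open>Q\<close> leaves the flag qubit alone, so by linearity each component is rotated
  with its flag intact. The abort component is rotated too, so after a Pauli it may differ from
  \<open>abt\<close>.\<close>

lemma conjugate_flagged_mixture:
  assumes R: "hermitian_involution (2 ^ q) R" and "pure_state q \<psi>" "pure_state q \<phi>"
  defines "Q \<equiv> tensor_mat (1\<^sub>m 2) R"
  shows "Q * (c \<cdot>\<^sub>m tensor_mat (proj (ket [False])) (proj \<psi>)
            + d \<cdot>\<^sub>m proj (tensor_vec (ket [True]) \<phi>)) * Q =
         c \<cdot>\<^sub>m proj (tensor_vec (ket [False]) (R *\<^sub>v \<psi>)) + d \<cdot>\<^sub>m proj (tensor_vec (ket [True]) (R *\<^sub>v \<phi>))"
    and "pure_state q (R *\<^sub>v \<psi>)"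
proof -
  let ?N = "2 * 2 ^ q"
  have k: "ket [b] \<in> carrier_vec 2" for b using ket_carrier[of "[b]"] by simp
  have c: "\<psi> \<in> carrier_vec (2 ^ q)" "\<phi> \<in> carrier_vec (2 ^ q)"
    using assms by (auto simp: pure_state_iff)
  have Q: "hermitian_involution ?N Q"
    unfolding Q_def by (intro hermitian_involution_tensor hermitian_involution_one R)
  have Qc: "Q \<in> carrier_mat ?N ?N" by (rule hermitian_involutionD(1)[OF Q])
  have conj: "Q * proj (tensor_vec (ket [b]) v) * Q = proj (tensor_vec (ket [b]) (R *\<^sub>v v))"
    if "v \<in> carrier_vec (2 ^ q)" for b v
    unfolding hermitian_involution_conjugate_proj[OF Q tensor_vec_carrier[OF k that]]
    unfolding Q_def tensor_mat_mult_vec[OF one_carrier_mat hermitian_involutionD(1)[OF R] k that]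
      one_mult_mat_vec[OF k] ..
  have lin: "Q * (c \<cdot>\<^sub>m A + d \<cdot>\<^sub>m B) * Q = c \<cdot>\<^sub>m (Q * A * Q) + d \<cdot>\<^sub>m (Q * B * Q)"
    if "A \<in> carrier_mat ?N ?N" "B \<in> carrier_mat ?N ?N" for A B
  proof -
    have "Q * (c \<cdot>\<^sub>m A + d \<cdot>\<^sub>m B) = c \<cdot>\<^sub>m (Q * A) + d \<cdot>\<^sub>m (Q * B)"
      using that Qc by (simp add: mult_add_distrib_mat[where nr = ?N and n = ?N and nc = ?N]
        mult_smult_distrib[where nr = ?N and n = ?N and nc = ?N])
    then show ?thesis
      using that Qc by (simp add: add_mult_distrib_mat[where nr = ?N and n = ?N and nc = ?N]
        mult_smult_assoc_mat[where nr = ?N and n = ?N and nc = ?N])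
  qed
  have "proj (tensor_vec (ket [b]) v) \<in> carrier_mat ?N ?N" if "v \<in> carrier_vec (2 ^ q)" for b v
    using tensor_vec_carrier[OF k that] by simp
  then show "Q * (c \<cdot>\<^sub>m tensor_mat (proj (ket [False])) (proj \<psi>)
            + d \<cdot>\<^sub>m proj (tensor_vec (ket [True]) \<phi>)) * Q =
         c \<cdot>\<^sub>m proj (tensor_vec (ket [False]) (R *\<^sub>v \<psi>)) + d \<cdot>\<^sub>m proj (tensor_vec (ket [True]) (R *\<^sub>v \<phi>))"
    unfolding tensor_mat_proj[OF k c(1)] using c by (simp add: lin conj)
  show "pure_state q (R *\<^sub>v \<psi>)"
    using assms(2) hermitian_involution_cscalar_prod[OF R c(1)] hermitian_involutionD(1)[OF R]
    by (simp add: pure_state_iff)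
qed

text \<open>The weight and both vectors are obtained before p and b. Their independence of p is what
  lets the twirl average over p with the vectors fixed.\<close>

lemma Phi_eq_mixture:
  assumes "recognizable_abort d_par n_par G Ghat abt" "length k = lam" "length x = d_par lam"
  obtains \<eta> \<psi> \<phi> where "0 \<le> \<eta>" "\<eta> \<le> 1" "pure_state (n_par lam) \<psi>" "pure_state (n_par lam) \<phi>"
    "abt lam = tensor_vec (ket [True]) \<phi>"
    "\<And>p b. length p = n_par lam \<Longrightarrow>
      Phi Ghat lam p k x b =
        complex_of_real \<eta> \<cdot>\<^sub>m
          proj (tensor_vec (ket [False]) ((if b then pauli_mat p else 1\<^sub>m (2 ^ n_par lam)) *\<^sub>v \<psi>)) +
        complex_of_real (1 - \<eta>) \<cdot>\<^sub>m
          proj (tensor_vec (ket [True]) ((if b then pauli_mat p else 1\<^sub>m (2 ^ n_par lam)) *\<^sub>v \<phi>))"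
proof -
  let ?n = "n_par lam"
  obtain \<phi> where \<phi>: "pure_state ?n \<phi>" "abt lam = tensor_vec (ket [True]) \<phi>"
    using assms(1) unfolding recognizable_abort_def by blast
  obtain \<eta> \<psi> where \<eta>: "0 \<le> \<eta>" "\<eta> \<le> 1" "pure_state ?n \<psi>"
    and ev: "eval_gen (Ghat lam) k x =
      complex_of_real \<eta> \<cdot>\<^sub>m tensor_mat (proj (ket [False])) (proj \<psi>)
      + complex_of_real (1 - \<eta>) \<cdot>\<^sub>m proj (abt lam)"
    using assms unfolding recognizable_abort_def by blast
  have "hermitian_involution (2 ^ ?n) (if b then pauli_mat p else 1\<^sub>m (2 ^ ?n))"
    if "length p = ?n" for p b
    using hermitian_involution_pauli_mat[of p] hermitian_involution_one that by simp
  then show ?thesis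
    by (intro that[OF \<eta> \<phi>]) (simp only: Phi_def Let_def ev \<phi>(2) conjugate_flagged_mixture(1)[OF _ \<eta>(3) \<phi>(1)])
qed

text \<open>The error guarantee in \<open>tomography_procedure\<close> covers density matrices only;
  this makes it available for \<open>Phi\<close>.\<close>

lemma density_matrix_Phi:
  assumes "recognizable_abort d_par n_par G Ghat abt" "length k = lam" "length x = d_par lam"
    "length p = n_par lam"
  shows "density_matrix (2 ^ (n_par lam + 1)) (Phi Ghat lam p k x b)"
proof -
  let ?n = "n_par lam"
  obtain \<eta> \<psi> \<phi> where *: "0 \<le> \<eta>" "\<eta> \<le> 1" "pure_state ?n \<psi>" "pure_state ?n \<phi>"
    and Phi: "\<And>p b. length p = ?n \<Longrightarrow> Phi Ghat lam p k x b =
        complex_of_real \<eta> \<cdot>\<^sub>m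
          proj (tensor_vec (ket [False]) ((if b then pauli_mat p else 1\<^sub>m (2 ^ ?n)) *\<^sub>v \<psi>)) +
        complex_of_real (1 - \<eta>) \<cdot>\<^sub>m
          proj (tensor_vec (ket [True]) ((if b then pauli_mat p else 1\<^sub>m (2 ^ ?n)) *\<^sub>v \<phi>))"
    using Phi_eq_mixture[OF assms(1-3)] by metis
  have R: "hermitian_involution (2 ^ ?n) (if b then pauli_mat p else 1\<^sub>m (2 ^ ?n))"
    using hermitian_involution_pauli_mat[of p] hermitian_involution_one assms(4) by simp
  show ?thesis
    unfolding Phi[OF assms(4)] Suc_eq_plus1[symmetric]
    by (intro density_matrix_mixture pure_state_flagged conjugate_flagged_mixture(2)[OF R _ *(3)] *)
qed

text \<open>
  The tolerance \<open>7 / 60\<close> exceeds \<open>(6 + 2 + sqrt 2) / 81\<close>: \<open>6 / 81\<close> is the test of the verifier,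
  \<open>2 / 81\<close> the distance of the selected estimate to a majority of the estimates, and
  \<open>sqrt (2 / 3 ^ 8)\<close> the error exceeded by a single estimate with probability at most \<open>1 / 8\<close>.
\<close>

definition verifiable ::
  "(nat \<Rightarrow> circuit) \<Rightarrow> (nat \<Rightarrow> complex Matrix.vec) \<Rightarrow> nat \<Rightarrow>
   pauli list \<Rightarrow> bool list \<Rightarrow> bool list \<Rightarrow> bool \<Rightarrow> complex mat \<Rightarrow> bool" where
  "verifiable Ghat abt lam p k x b M \<longleftrightarrow>
     density_matrix (2 ^ (n_par lam + 1)) M \<and>
     Re ((M *\<^sub>v abt lam) \<bullet>c abt lam) \<le> 1 / 9 \<and>
     frob_norm (M - Phi Ghat lam p k x b) \<le> 7 / 60"

text \<open>
  Only the state of the opening to \<open>False\<close> has \<open>abt\<close> itself as its abort component, so the abort test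
  bounds the abort weight of that state but not of the other one. With the tolerance \<open>7 / 60\<close> of
  \<open>verifiable\<close>, the overlap is at least \<open>8 / 9 - 3 * (7 / 60) > 1 / 2\<close>.
\<close>

lemma card_doubly_verifiable:
  assumes ra: "recognizable_abort d_par n_par G Ghat abt"
    and k: "length k = lam" "length k' = lam" and x: "length x = d_par lam"
  shows "real (card {p. length p = n_par lam \<and>
      (\<exists>M. verifiable Ghat abt lam p k x True M \<and> verifiable Ghat abt lam p k' x False M)})
    \<le> 2 * 2 ^ n_par lam"
proof -
  let ?n = "n_par lam" and ?N = "2 ^ (n_par lam + 1) :: nat"
  obtain \<eta> \<psi> \<phi> where 1: "0 \<le> \<eta>" "\<eta> \<le> 1" "pure_state ?n \<psi>" "pure_state ?n \<phi>"
    and Phi1: "\<And>p b. length p = ?n \<Longrightarrow> Phi Ghat lam p k x b =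
        complex_of_real \<eta> \<cdot>\<^sub>m
          proj (tensor_vec (ket [False]) ((if b then pauli_mat p else 1\<^sub>m (2 ^ ?n)) *\<^sub>v \<psi>)) +
        complex_of_real (1 - \<eta>) \<cdot>\<^sub>m
          proj (tensor_vec (ket [True]) ((if b then pauli_mat p else 1\<^sub>m (2 ^ ?n)) *\<^sub>v \<phi>))"
    using Phi_eq_mixture[OF ra k(1) x] by metis
  obtain \<eta>' \<psi>' \<phi>' where 2: "0 \<le> \<eta>'" "\<eta>' \<le> 1" "pure_state ?n \<psi>'" "pure_state ?n \<phi>'"
    and abt: "abt lam = tensor_vec (ket [True]) \<phi>'"
    and Phi2: "\<And>p b. length p = ?n \<Longrightarrow> Phi Ghat lam p k' x b =
        complex_of_real \<eta>' \<cdot>\<^sub>m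
          proj (tensor_vec (ket [False]) ((if b then pauli_mat p else 1\<^sub>m (2 ^ ?n)) *\<^sub>v \<psi>')) +
        complex_of_real (1 - \<eta>') \<cdot>\<^sub>m
          proj (tensor_vec (ket [True]) ((if b then pauli_mat p else 1\<^sub>m (2 ^ ?n)) *\<^sub>v \<phi>'))"
    using Phi_eq_mixture[OF ra k(2) x] by metis
  define ov where "ov p = (cmod ((pauli_mat p *\<^sub>v \<psi>) \<bullet>c \<psi>'))\<^sup>2" for p
  let ?B = "{p. length p = ?n \<and> (\<exists>M. verifiable Ghat abt lam p k x True M \<and> verifiable Ghat abt lam p k' x False M)}"
  have close: "1 / 2 \<le> ov p" if "p \<in> ?B" for p
  proof -
    from that obtain M where p: "length p = ?n" and M: "verifiable Ghat abt lam p k x True M"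
      "verifiable Ghat abt lam p k' x False M" by blast
    let ?\<rho> = "Phi Ghat lam p k x True" and ?\<rho>' = "Phi Ghat lam p k' x False"
    let ?v = "tensor_vec (ket [False]) \<psi>'" and ?a = "abt lam"
    have carr: "M \<in> carrier_mat ?N ?N" "?\<rho> \<in> carrier_mat ?N ?N" "?\<rho>' \<in> carrier_mat ?N ?N"
      using M(1) density_matrix_Phi[OF ra k(1) x p] density_matrix_Phi[OF ra k(2) x p]
      by (auto simp: verifiable_def density_matrix_def)
    have R: "hermitian_involution (2 ^ ?n) (pauli_mat p)"
      using hermitian_involution_pauli_mat[of p] p by simp
    have P\<psi>: "pure_state ?n (pauli_mat p *\<^sub>v \<psi>)" and P\<phi>: "pure_state ?n (pauli_mat p *\<^sub>v \<phi>)"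
      using conjugate_flagged_mixture(2)[OF R] 1 by blast+
    have \<rho>: "?\<rho> = complex_of_real \<eta> \<cdot>\<^sub>m proj (tensor_vec (ket [False]) (pauli_mat p *\<^sub>v \<psi>)) +
        complex_of_real (1 - \<eta>) \<cdot>\<^sub>m proj (tensor_vec (ket [True]) (pauli_mat p *\<^sub>v \<phi>))"
      using Phi1[OF p, of True] by simp
    have \<rho>': "?\<rho>' = complex_of_real \<eta>' \<cdot>\<^sub>m proj ?v + complex_of_real (1 - \<eta>') \<cdot>\<^sub>m proj ?a"
      using Phi2[OF p, of False] abt 2 by (simp add: pure_state_iff)
    have v: "pure_state (Suc ?n) ?v" and a: "pure_state (Suc ?n) ?a"
      unfolding abt using 2 by (auto intro: pure_state_flagged)
    have fl: "tensor_vec (ket [b]) w \<in> carrier_vec ?N" if "pure_state ?n w" for b w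
      using pure_state_flagged[OF that, of b] by (simp add: pure_state_iff)
    have qa: "cmod (qform A ?a) \<le> frob_norm A" and qv: "cmod (qform A ?v) \<le> frob_norm A"
      if "A \<in> carrier_mat ?N ?N" for A
      using cmod_qform_le[OF that] v a by (simp_all add: pure_state_def)
    have ac: "?a \<in> carrier_vec ?N" and vc: "?v \<in> carrier_vec ?N"
      using v a by (simp_all add: pure_state_def)
    have mix: "qform (complex_of_real c \<cdot>\<^sub>m proj u + complex_of_real d \<cdot>\<^sub>m proj w) z =
        complex_of_real (c * (cmod (u \<bullet>c z))\<^sup>2 + d * (cmod (w \<bullet>c z))\<^sup>2)"
      if "u \<in> carrier_vec ?N" "w \<in> carrier_vec ?N" "z \<in> carrier_vec ?N" for c d u w z
      using that by (simp add: qform_add[where N = ?N] qform_smult[where N = ?N] qform_proj[where N = ?N])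
    have "?v \<bullet>c ?a = 0" "?a \<bullet>c ?a = 1" "?v \<bullet>c ?v = 1" "?a \<bullet>c ?v = 0"
      unfolding abt using 2(3,4)[unfolded pure_state_iff]
      by (simp_all add: cscalar_prod_flagged[OF 2(3) 2(4)] cscalar_prod_flagged[OF 2(4) 2(3)]
        cscalar_prod_flagged[OF 2(3) 2(3)] cscalar_prod_flagged[OF 2(4) 2(4)])
    then have q\<rho>'a: "qform ?\<rho>' ?a = complex_of_real (1 - \<eta>')" and q\<rho>'v: "qform ?\<rho>' ?v = complex_of_real \<eta>'"
      unfolding \<rho>' using ac vc by (simp_all only: mix) simp_all
    \<comment> \<open>The abort component carries the other flag and contributes nothing at
      \<open>?v\<close>.\<close>
    have q\<rho>v: "qform ?\<rho> ?v = complex_of_real (\<eta> * ov p)"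
      unfolding \<rho> mix[OF fl[OF P\<psi>] fl[OF P\<phi>] vc] ov_def
      unfolding cscalar_prod_flagged[OF P\<psi> 2(3)] cscalar_prod_flagged[OF P\<phi> 2(3)] by simp
    \<comment> \<open>M passes the abort test, and its expectation at \<open>abt\<close> differs
      from that of \<open>?\<rho>'\<close> by at most the tolerance.\<close>
    have "Re (qform ?\<rho>' ?a) \<le> 1 / 9 + 7 / 60"
    proof -
      have "Re (qform M ?a) \<le> 1 / 9" using M by (simp add: verifiable_def qform_def)
      moreover have "cmod (qform (M - ?\<rho>') ?a) \<le> 7 / 60"
        using qa[OF minus_carrier_mat[OF carr(3)], of M] M(2) by (simp add: verifiable_def)
      moreover have "qform (M - ?\<rho>') ?a = qform M ?a - qform ?\<rho>' ?a"
        using carr ac by (simp add: qform_minus[where N = ?N])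
      ultimately show ?thesis
        using abs_Re_le_cmod[of "qform (M - ?\<rho>') ?a"] by simp
    qed
    then have \<eta>': "\<eta>' \<ge> 8 / 9 - 7 / 60" unfolding q\<rho>'a by simp
    have "cmod (qform (M - ?\<rho>) ?v) \<le> 7 / 60" "cmod (qform (M - ?\<rho>') ?v) \<le> 7 / 60"
      using qv[OF minus_carrier_mat[OF carr(2)], of M] qv[OF minus_carrier_mat[OF carr(3)], of M] M
      by (simp_all add: verifiable_def)
    moreover have "qform (M - ?\<rho>) ?v = qform M ?v - \<eta> * ov p" "qform (M - ?\<rho>') ?v = qform M ?v - \<eta>'"
      using carr vc by (simp_all add: qform_minus[where N = ?N] q\<rho>'v q\<rho>v)
    \<comment> \<open>Both states are compared with M at the same vector \<open>?v\<close>; M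
      cancels and two tolerances remain.\<close>
    ultimately have "\<eta>' - \<eta> * ov p \<le> 7 / 30"
      using abs_Re_le_cmod[of "qform (M - ?\<rho>) ?v"] abs_Re_le_cmod[of "qform (M - ?\<rho>') ?v"] by simp
    moreover have "\<eta> * ov p \<le> ov p"
      using 1 by (simp add: mult_left_le_one_le ov_def)
    ultimately show ?thesis using \<eta>' by simp
  qed
  \<comment> \<open>Counting by averaging: each bad p takes at least 1 / 2 of a total overlap of 2 ^
    n.\<close>
  have "real (card ?B) * (1 / 2) = (\<Sum>p\<in>?B. 1 / 2)" by simp
  also have "\<dots> \<le> (\<Sum>p\<in>?B. ov p)" by (rule sum_mono) (rule close)
  also have "\<dots> \<le> (\<Sum>p | length p = ?n. ov p)"
    by (rule sum_mono2[OF finite_lists_of_length]) (auto simp: ov_def)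
  also have "\<dots> = 2 ^ ?n"
    unfolding ov_def using sum_pauli_mat_overlap[of \<psi>' ?n \<psi>] 1 2 by (simp add: pure_state_def)
  finally show ?thesis by simp
qed

section \<open>Soundness of verification\<close>

lemma prob_bind_pmf_le:
  fixes c e :: real
  assumes "0 \<le> c" "0 \<le> e"
    and "\<And>x. x \<in> set_pmf p \<Longrightarrow> x \<in> B \<Longrightarrow> measure_pmf.prob (f x) A \<le> c"
    and "\<And>x. x \<in> set_pmf p \<Longrightarrow> x \<notin> B \<Longrightarrow> measure_pmf.prob (f x) A \<le> e"
  shows "measure_pmf.prob (bind_pmf p f) A \<le> measure_pmf.prob p B * c + e"
proof -
  have "ennreal (measure_pmf.prob (bind_pmf p f) A) = emeasure (bind_pmf p f) A"
    by (simp add: measure_pmf.emeasure_eq_measure)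
  also have "\<dots> = (\<integral>\<^sup>+x. emeasure (f x) A \<partial>p)"
    by (rule emeasure_bind_pmf)
  also have "\<dots> \<le> (\<integral>\<^sup>+x. ennreal c * indicator B x + ennreal e \<partial>p)"
  proof (rule nn_integral_mono_AE, unfold AE_measure_pmf_iff, rule ballI)
    fix x assume "x \<in> set_pmf p"
    with assms have "measure_pmf.prob (f x) A \<le> c * indicator B x + e"
      by (cases "x \<in> B") (auto intro: add_increasing2)
    then show "emeasure (f x) A \<le> ennreal c * indicator B x + ennreal e"
      using assms(1,2)
      by (cases "x \<in> B") (auto simp: measure_pmf.emeasure_eq_measure simp flip: ennreal_plus intro: ennreal_leI)
  qed
  also have "\<dots> = ennreal c * emeasure p B + ennreal e"
    by (simp add: nn_integral_add nn_integral_cmult)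
  also have "\<dots> = ennreal (measure_pmf.prob p B * c + e)"
    using assms(1,2) by (simp add: measure_pmf.emeasure_eq_measure ennreal_mult' ennreal_plus mult.commute)
  finally have "ennreal (measure_pmf.prob (bind_pmf p f) A) \<le> ennreal (measure_pmf.prob p B * c + e)" .
  then show ?thesis
    by (rule ennreal_le_iff[THEN iffD1, rotated]) (use assms(1,2) in simp)
qed

lemma prob_bind_pmf_le_const:
  fixes e :: real
  assumes "0 \<le> e" and "\<And>x. x \<in> set_pmf p \<Longrightarrow> measure_pmf.prob (f x) A \<le> e"
  shows "measure_pmf.prob (bind_pmf p f) A \<le> e"
  using prob_bind_pmf_le[of 0 e p "{}" f A] assms by simp

text \<open>Lets events be compared using facts that hold on the support only, such as the
  dimensions of sampled matrices.\<close>

lemma prob_pmf_mono_on_support: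
  assumes "set_pmf p \<inter> A \<subseteq> B"
  shows "measure_pmf.prob p A \<le> measure_pmf.prob p B"
  using assms by (intro measure_pmf.finite_measure_mono_AE) (auto simp: AE_measure_pmf_iff)

text \<open>A union bound, cruder than Chernoff, over the sets of m positions at which
  \<open>F\<close> may hold; there are at most 2 ^ n of them. The induction conditions on the first
  sample.\<close>

lemma prob_replicate_pmf_count_ge:
  assumes p: "measure_pmf.prob D {x. F x} \<le> p" and "0 \<le> p"
  shows "measure_pmf.prob (replicate_pmf n D) {xs. m \<le> length (filter F xs)} \<le> 2 ^ n * p ^ m"
proof (induction n arbitrary: m)
  case 0
  show ?case
  proof (cases m)
    case (Suc m')
    then show ?thesis using \<open>0 \<le> p\<close> by simp
  qed simp
next
  case (Suc n)
  show ?case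
  proof (cases m)
    case 0
    have "measure_pmf.prob (replicate_pmf (Suc n) D) {xs. m \<le> length (filter F xs)} \<le> 1"
      by (rule measure_pmf.prob_le_1)
    also have "(1::real) \<le> 2 ^ Suc n" by (rule one_le_power) simp
    finally show ?thesis using 0 by simp
  next
    case m: (Suc m')
    \<comment> \<open>A first sample in \<open>F\<close> leaves \<open>m'\<close> hits to be found,
      any other leaves m.\<close>
    have step: "measure_pmf.prob (replicate_pmf n D \<bind> (\<lambda>xs. return_pmf (x # xs)))
        {xs. m \<le> length (filter F xs)} =
      measure_pmf.prob (replicate_pmf n D) {xs. (if F x then m' else m) \<le> length (filter F xs)}" for x
      unfolding map_pmf_def[symmetric] using m by (auto simp: vimage_def)
    have "measure_pmf.prob (replicate_pmf (Suc n) D) {xs. m \<le> length (filter F xs)} \<le>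
        measure_pmf.prob D {x. F x} * (2 ^ n * p ^ m') + 2 ^ n * p ^ m"
      unfolding replicate_pmf.simps
      by (rule prob_bind_pmf_le) (use Suc.IH[of m'] Suc.IH[of m] \<open>0 \<le> p\<close> in \<open>auto simp: step\<close>)
    also have "\<dots> \<le> p * (2 ^ n * p ^ m') + 2 ^ n * p ^ m"
      using p \<open>0 \<le> p\<close> by (intro add_right_mono mult_right_mono) auto
    \<comment> \<open>Both summands are 2 ^ n * p ^ m, hence one factor 2 per sample.\<close>
    also have "\<dots> = 2 ^ Suc n * p ^ m" using m by simp
    finally show ?thesis .
  qed
qed

text \<open>Markov's inequality for the squared error, whose expectation is at most N / s.\<close>

lemma tomo_error_prob:
  assumes "tomography_procedure T" "density_matrix N \<rho>" "1 \<le> s" "1 \<le> N" "0 < r"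
  shows "measure_pmf.prob (tomo T s N \<rho>) {M. r \<le> (frob_norm (M - \<rho>))\<^sup>2} \<le> real N / (s * r)"
proof -
  let ?p = "measure_pmf (tomo T s N \<rho>)"
  have "{M. r \<le> (frob_norm (M - \<rho>))\<^sup>2} =
      {M \<in> UNIV. 1 \<le> ennreal (1 / r) * ennreal ((frob_norm (M - \<rho>))\<^sup>2)}"
    using \<open>0 < r\<close> by (auto simp: ennreal_1[symmetric] ennreal_mult'[symmetric] field_simps
      simp del: ennreal_1)
  then have "emeasure ?p {M. r \<le> (frob_norm (M - \<rho>))\<^sup>2} \<le>
      ennreal (1 / r) * (\<integral>\<^sup>+ M. ennreal ((frob_norm (M - \<rho>))\<^sup>2) * indicator UNIV M \<partial>?p)"
    using nn_integral_Markov_inequality[of "\<lambda>M. ennreal ((frob_norm (M - \<rho>))\<^sup>2)" UNIV ?p "ennreal (1 / r)"]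
    by simp
  also have "\<dots> \<le> ennreal (1 / r) * ennreal (real N / real s)"
    using assms(1-4) by (intro mult_left_mono) (auto simp: tomography_procedure_def)
  also have "\<dots> = ennreal (real N / (s * r))"
    using \<open>0 < r\<close> by (simp add: ennreal_mult'[symmetric] mult.commute)
  finally show ?thesis
    using \<open>0 < r\<close> by (simp add: measure_pmf.emeasure_eq_measure)
qed

text \<open>Pigeonhole, counted with multiplicity because estimates may repeat.\<close>

lemma filters_intersect:
  assumes "length xs < length (filter P xs) + length (filter Q xs)"
  shows "\<exists>x\<in>set xs. P x \<and> Q x"
proof (rule ccontr)
  assume "\<not> ?thesis"
  then have "filter Q xs = filter (\<lambda>x. Q x \<and> \<not> P x) xs" by (intro filter_cong) auto
  then have "length (filter Q xs) \<le> length (filter (\<lambda>x. \<not> P x) xs)"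
    using filter_filter[of Q "\<lambda>x. \<not> P x" xs] length_filter_le[of Q "filter (\<lambda>x. \<not> P x) xs"]
    by (simp add: conj_commute)
  then show False using assms sum_length_filter_compl[of P xs] by simp
qed

text \<open>Here 1 / 8 is the failure probability of one run and m is at least half of the runs. The
  exponent of 8 ^ m in base 2 is 3 * m, at least 3 / 2 * lam, which outweighs the 2 ^ lam of the
  union bound.\<close>

lemma two_powr_half_bound:
  assumes "lam \<le> 2 * m"
  shows "2 ^ lam * (1 / 8) ^ m \<le> (2::real) powr (- 0.5 * real lam)"
proof -
  have "(8::real) ^ m = 2 ^ (3 * m)" by (simp add: power_mult)
  then have "2 ^ lam * (1 / 8) ^ m = (2::real) powr (real lam - 3 * real m)"
    by (simp add: power_one_over powr_diff flip: powr_realpow)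
  also have "\<dots> \<le> 2 powr (- 0.5 * real lam)"
    using assms by (intro powr_mono) (auto simp flip: of_nat_le_iff[where 'a = real])
  finally show ?thesis .
qed

text \<open>From lam = 16 on, n is at least 12. Rounding up in d gives the first bound and, unless d
  = 0, loses at most a factor 2, so that 2 ^ d is at most 6 * lam / n.\<close>

lemma parameter_bounds:
  assumes "16 \<le> lam"
  shows "3 * real lam \<le> real (n_par lam) * 2 ^ d_par lam" "2 ^ d_par lam \<le> real lam / 2"
proof -
  have "log 2 16 \<le> log 2 (real lam)" using assms by simp
  moreover have "log 2 (16::real) = 4" using log_pow_cancel[of "2::real" 4] by simp
  ultimately have "12 \<le> 3 * log 2 (real lam)" by simp
  also have "\<dots> \<le> real (n_par lam)" unfolding n_par_def by linarith
  finally have n: "12 \<le> real (n_par lam)" .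
  define y where "y = 3 * real lam / real (n_par lam)"
  have y: "0 < y" using n assms by (simp add: y_def)
  have D: "(2::real) ^ d_par lam = 2 powr real (d_par lam)" by (simp add: powr_realpow)
  have "log 2 y \<le> real (d_par lam)" unfolding d_par_def y_def by linarith
  then have "y \<le> 2 powr real (d_par lam)" using y by (simp add: log_le_iff)
  then show "3 * real lam \<le> real (n_par lam) * 2 ^ d_par lam"
    using n by (simp add: D y_def field_simps)
  show "2 ^ d_par lam \<le> real lam / 2"
  proof (cases "log 2 y \<le> 0")
    \<comment> \<open>Here \<open>nat\<close> makes d equal to 0, so the factor 2 estimate is
      replaced by 2 ^ d = 1.\<close>
    case True
    then have "d_par lam = 0" by (simp add: d_par_def y_def)
    then show ?thesis using assms by simp
  next
    case False
    then have "real (d_par lam) \<le> log 2 y + 1" unfolding d_par_def y_def by linarith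
    then have "2 ^ d_par lam \<le> 2 powr (log 2 y + 1)" unfolding D by simp
    also have "\<dots> = 2 * y" using y by (simp add: powr_add)
    also have "\<dots> \<le> real lam / 2"
      using n assms mult_left_mono[OF n, of "real lam"] by (simp add: y_def field_simps)
    finally show ?thesis .
  qed
qed

text \<open>The exponent is 2 * lam + D - n * D with D = 2 ^ d. The bound n * D \<ge> 3 * lam leaves
  D - lam, and D \<le> lam / 2 absorbs the D that comes from the numerator 2.\<close>

lemma union_bound_estimate:
  assumes "16 \<le> lam"
  shows "2 ^ lam * 2 ^ lam * (2 / 2 ^ n_par lam) ^ 2 ^ d_par lam \<le> (2::real) powr (- 0.5 * real lam)"
proof -
  let ?D = "2 ^ d_par lam :: nat"
  have "(2::real) / 2 ^ n_par lam = 2 powr (1 - real (n_par lam))"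
    by (simp add: powr_diff powr_realpow)
  then have "(2 / 2 ^ n_par lam) ^ ?D = (2::real) powr ((1 - real (n_par lam)) * real ?D)"
    by (simp add: powr_power mult.commute)
  moreover have "(2::real) ^ lam = 2 powr real lam" by (simp add: powr_realpow)
  ultimately have "2 ^ lam * 2 ^ lam * (2 / 2 ^ n_par lam) ^ ?D =
      (2::real) powr (2 * real lam + (1 - real (n_par lam)) * real ?D)"
    by (simp add: powr_add[symmetric])
  also have "\<dots> \<le> 2 powr (- 0.5 * real lam)"
    using parameter_bounds[OF assms] by (intro powr_mono) (auto simp: algebra_simps)
  finally show ?thesis .
qed

text \<open>More than half of the estimates are near \<open>M\<close> by selection and more than
  half are near \<open>\<rho>\<close> by hypothesis; an estimate in both majorities links the two by
  the triangle inequality.\<close>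

lemma select_mat_close:
  assumes "select_mat \<delta> Ms = Some M" "\<And>A. A \<in> set Ms \<Longrightarrow> A \<in> carrier_mat N N" "\<rho> \<in> carrier_mat N N"
    and "2 * length (filter (\<lambda>A. r \<le> (frob_norm (A - \<rho>))\<^sup>2) Ms) < length Ms"
  shows "M \<in> carrier_mat N N" "frob_norm (M - \<rho>) \<le> sqrt \<delta> + sqrt r"
proof -
  let ?F = "\<lambda>A. r \<le> (frob_norm (A - \<rho>))\<^sup>2"
  have M: "M \<in> set Ms" "length Ms < 2 * length (filter (\<lambda>A. (frob_norm (A - M))\<^sup>2 \<le> \<delta>) Ms)"
    using assms(1) unfolding select_mat_def find_Some_iff by auto
  then show c: "M \<in> carrier_mat N N" using assms(2) by blast
  have "length Ms < length (filter (\<lambda>A. (frob_norm (A - M))\<^sup>2 \<le> \<delta>) Ms) + length (filter (\<lambda>A. \<not> ?F A) Ms)"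
    using M(2) assms(4) sum_length_filter_compl[of ?F Ms] by linarith
  from filters_intersect[OF this] obtain A where A: "A \<in> set Ms" "(frob_norm (A - M))\<^sup>2 \<le> \<delta>" "\<not> ?F A"
    by blast
  have "frob_norm (M - \<rho>) \<le> frob_norm (M - A) + frob_norm (A - \<rho>)"
    using c assms(2)[OF A(1)] assms(3) by (rule frob_norm_triangle)
  also have "frob_norm (M - A) = frob_norm (A - M)"
    using c assms(2)[OF A(1)] by (rule frob_norm_minus_commute)
  also have "\<dots> \<le> sqrt \<delta>" using A(2) by (rule real_le_rsqrt)
  also have "frob_norm (A - \<rho>) \<le> sqrt r" using A(3) by (intro real_le_rsqrt) simp
  finally show "frob_norm (M - \<rho>) \<le> sqrt \<delta> + sqrt r" by simp
qed

text \<open>Acceptance of a matrix that is not verifiable forces at least half of the runs to be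
  bad, since otherwise the triangle inequality would place it within the tolerance.\<close>

lemma verify_soundness:
  assumes T: "tomography_procedure T" and ra: "recognizable_abort d_par n_par G Ghat abt"
    and len: "length k = lam" "length x = d_par lam" "length p = n_par lam"
    and nv: "\<not> verifiable Ghat abt lam p k x b M"
  shows "measure_pmf.prob (verify T Ghat abt lam p k x b M) {Valid} \<le> 2 powr (- 0.5 * real lam)"
proof -
  let ?N = "2 ^ (n_par lam + 1) :: nat" and ?s = "3 ^ 8 * 2 ^ (n_par lam + 1) :: nat"
  let ?\<rho> = "Phi Ghat lam p k x b"
  let ?D = "tomo T (4 * ?s) ?N ?\<rho>"
  let ?F = "\<lambda>A. 2 / 3 ^ 8 \<le> (frob_norm (A - ?\<rho>))\<^sup>2"
  \<comment> \<open>The verdict as a function of the tomography outcome, so that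
    \<open>verify\<close> becomes an image of the \<open>lam\<close> independent runs.\<close>
  define g where "g Mhat = (if \<not> density_matrix ?N M then Invalid
          else if Re ((M *\<^sub>v abt lam) \<bullet>c abt lam) > 1 / 9 then Invalid
          else case Mhat of
            None \<Rightarrow> Invalid
          | Some M' \<Rightarrow> if (frob_norm (M - M'))\<^sup>2 \<le> 4 / 729 then Valid else Invalid)" for Mhat
  \<comment> \<open>Half of \<open>lam\<close> rounded up: fewer than m bad runs are strictly less
    than half.\<close>
  define m where "m = (lam + 1) div 2"
  have \<rho>: "density_matrix ?N ?\<rho>" by (rule density_matrix_Phi[OF ra len])
  then have \<rho>c: "?\<rho> \<in> carrier_mat ?N ?N" by (simp add: density_matrix_def)
  have "measure_pmf.prob ?D {A. ?F A} \<le> real ?N / (real (4 * ?s) * (2 / 3 ^ 8))"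
    by (rule tomo_error_prob[OF T \<rho>]) auto
  \<comment> \<open>As \<open>?s\<close> is 3 ^ 8 times \<open>?N\<close>, the dimension cancels and
    1 / (4 * 2) remains.\<close>
  also have "\<dots> = 1 / 8" by simp
  finally have D: "measure_pmf.prob ?D {A. ?F A} \<le> 1 / 8" .
  have \<delta>: "4 * real ?N / real ?s = (2 / 81)\<^sup>2" by (simp add: power2_eq_square)
  have "verify T Ghat abt lam p k x b M =
      map_pmf (\<lambda>Ms. g (select_mat (4 * real ?N / real ?s) Ms)) (replicate_pmf lam ?D)"
    unfolding verify_def tomography_def tomo_imp_def g_def
    by (simp only: map_pmf_def[symmetric] map_pmf_comp)
  then have "measure_pmf.prob (verify T Ghat abt lam p k x b M) {Valid} =
      measure_pmf.prob (replicate_pmf lam ?D) {Ms. g (select_mat ((2 / 81)\<^sup>2) Ms) = Valid}"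
    unfolding \<delta> by (simp add: vimage_def)
  also have "\<dots> \<le> measure_pmf.prob (replicate_pmf lam ?D) {Ms. m \<le> length (filter ?F Ms)}"
  proof (rule prob_pmf_mono_on_support, rule subsetI, rule ccontr)
    fix Ms assume Ms: "Ms \<in> set_pmf (replicate_pmf lam ?D) \<inter> {Ms. g (select_mat ((2 / 81)\<^sup>2) Ms) = Valid}"
      and few: "Ms \<notin> {Ms. m \<le> length (filter ?F Ms)}"
    have carr: "A \<in> carrier_mat ?N ?N" if "A \<in> set Ms" for A
      using Ms that by (auto simp: set_replicate_pmf tomo_def mat_of_bits_def)
    have len: "length Ms = lam" using Ms by (auto simp: set_replicate_pmf)
    have "g (select_mat ((2 / 81)\<^sup>2) Ms) = Valid" using Ms by simp
    then obtain M' where M: "density_matrix ?N M" "Re ((M *\<^sub>v abt lam) \<bullet>c abt lam) \<le> 1 / 9"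
      and M': "select_mat ((2 / 81)\<^sup>2) Ms = Some M'" "(frob_norm (M - M'))\<^sup>2 \<le> 4 / 729"
      unfolding g_def by (auto split: if_splits option.splits)
    have "2 * length (filter ?F Ms) < length Ms" using few len by (auto simp: m_def)
    from select_mat_close[OF M'(1) carr \<rho>c this]
    have M'c: "M' \<in> carrier_mat ?N ?N" and "frob_norm (M' - ?\<rho>) \<le> 2 / 81 + sqrt (2 / 3 ^ 8)" by simp_all
    \<comment> \<open>The value 1.45 makes (2 + 1.45 + 6) / 81 exactly 7 / 60; the 6 / 81 below is
      the square root of 4 / 729.\<close>
    moreover have "sqrt (2 / 3 ^ 8) \<le> 1.45 / 81" by (rule real_le_lsqrt) (simp_all add: power2_eq_square)
    moreover have "frob_norm (M - M') \<le> 6 / 81"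
      using M'(2) by (intro power2_le_imp_le[of "frob_norm (M - M')"]) (simp_all add: power2_eq_square)
    moreover have "frob_norm (M - ?\<rho>) \<le> frob_norm (M - M') + frob_norm (M' - ?\<rho>)"
      using M(1) M'c \<rho>c by (intro frob_norm_triangle) (auto simp: density_matrix_def)
    ultimately have "frob_norm (M - ?\<rho>) \<le> 7 / 60" by simp
    then show False using nv M by (simp add: verifiable_def)
  qed
  also have "\<dots> \<le> 2 ^ lam * (1 / 8) ^ m"
    by (rule prob_replicate_pmf_count_ge[OF D]) simp
  also have "\<dots> \<le> 2 powr (- 0.5 * real lam)"
    by (rule two_powr_half_bound) (simp add: m_def)
  finally show ?thesis .
qed

section \<open>Equivocation and the binding game\<close>

definition openable ::
  "(nat \<Rightarrow> circuit) \<Rightarrow> (nat \<Rightarrow> complex Matrix.vec) \<Rightarrow> nat \<Rightarrow> transcript \<Rightarrow> bool list \<Rightarrow> bool \<Rightarrow> bool" where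
  "openable Ghat abt lam \<tau> k b \<longleftrightarrow> length k = lam \<and>
     (\<forall>x. length x = d_par lam \<longrightarrow>
        verifiable Ghat abt lam (fst \<tau> x) k x b (committed_mat lam (snd \<tau>) x))"

text \<open>The receiver accepts only if every input passes, so one input with a matrix that is not
  verifiable suffices; its verdict is a marginal of the product distribution.\<close>

lemma receiver_output_soundness:
  assumes T: "tomography_procedure T" and ra: "recognizable_abort d_par n_par G Ghat abt"
    and len: "\<And>x. length x = d_par lam \<Longrightarrow> length (fst \<tau> x) = n_par lam"
    and no: "\<And>k. \<not> openable Ghat abt lam \<tau> k b"
  shows "measure_pmf.prob (receiver_output T Ghat abt lam \<tau> opening) {Some b} \<le> 2 powr (- 0.5 * real lam)"
proof (cases "drop lam opening = [b]")
  case True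
  let ?k = "take lam opening" and ?X = "{x :: bool list. length x = d_par lam}"
  let ?v = "\<lambda>x. verify T Ghat abt lam (fst \<tau> x) ?k x b (committed_mat lam (snd \<tau>) x)"
  let ?V = "Pi_pmf ?X Invalid ?v"
  \<comment> \<open>A remainder of exactly one bit shows that the opening is long enough for
    \<open>take\<close> to yield a full key.\<close>
  have "length opening - lam = 1" using arg_cong[OF True, of length] by simp
  then have k: "length ?k = lam" by simp
  with no[of ?k] obtain x where x: "length x = d_par lam"
    and nv: "\<not> verifiable Ghat abt lam (fst \<tau> x) ?k x b (committed_mat lam (snd \<tau>) x)"
    by (auto simp: openable_def)
  have "receiver_output T Ghat abt lam \<tau> opening =
      map_pmf (\<lambda>V. if \<forall>x. length x = d_par lam \<longrightarrow> V x = Valid then Some b else None) ?V"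
    unfolding receiver_output_def True by (simp add: map_pmf_def)
  then have "measure_pmf.prob (receiver_output T Ghat abt lam \<tau> opening) {Some b} =
      measure_pmf.prob ?V {V. \<forall>x. length x = d_par lam \<longrightarrow> V x = Valid}"
    by (auto simp: vimage_def intro!: arg_cong[where f = "measure_pmf.prob ?V"])
  also have "\<dots> \<le> measure_pmf.prob ?V {V. V x = Valid}"
    by (rule prob_pmf_mono_on_support) (use x in auto)
  also have "\<dots> = measure_pmf.prob (map_pmf (\<lambda>V. V x) ?V) {Valid}"
    by (simp add: vimage_def)
  also have "map_pmf (\<lambda>V. V x) ?V = ?v x"
    using x by (simp add: Pi_pmf_component finite_lists_of_length)
  also have "measure_pmf.prob (?v x) {Valid} \<le> 2 powr (- 0.5 * real lam)"
    by (rule verify_soundness[OF T ra k x len[OF x] nv])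
  finally show ?thesis .
next
  case False
  \<comment> \<open>For any other remainder \<open>Some b\<close> lies outside the support.\<close>
  have "measure_pmf.prob (receiver_output T Ghat abt lam \<tau> opening) {Some b} \<le>
      measure_pmf.prob (receiver_output T Ghat abt lam \<tau> opening) {}"
    by (rule prob_pmf_mono_on_support)
      (use False in \<open>auto simp: receiver_output_def split: list.splits if_splits\<close>)
  also have "\<dots> \<le> 2 powr (- 0.5 * real lam)" by simp
  finally show ?thesis .
qed

text \<open>The message is chosen after P, so the event quantifies over it. Asking instead for some
  matrix at each input separately removes the message and leaves, for fixed keys, a condition on
  each \<open>P x\<close> alone, to which independence applies.\<close>

lemma equivocation_prob:
  assumes ra: "recognizable_abort d_par n_par G Ghat abt" and "16 \<le> lam"
  shows "measure_pmf.prob (receiver_paulis lam)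
      {P. \<exists>msg k k'. openable Ghat abt lam (P, msg) k True \<and> openable Ghat abt lam (P, msg) k' False}
    \<le> 2 powr (- 0.5 * real lam)"
proof -
  let ?X = "{x :: bool list. length x = d_par lam}" and ?K = "{k :: bool list. length k = lam}"
  let ?L = "{p :: pauli list. length p = n_par lam}"
  define Q where "Q k k' x = {p. \<exists>M. verifiable Ghat abt lam p k x True M \<and> verifiable Ghat abt lam p k' x False M}"
    for k k' x
  have Q: "measure_pmf.prob (pmf_of_set ?L) (Q k k' x) \<le> 2 / 2 ^ n_par lam"
    if "k \<in> ?K" "k' \<in> ?K" "x \<in> ?X" for k k' x
  proof -
    have "?L \<inter> Q k k' x = {p. length p = n_par lam \<and>
        (\<exists>M. verifiable Ghat abt lam p k x True M \<and> verifiable Ghat abt lam p k' x False M)}"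
      by (auto simp: Q_def)
    then have "real (card (?L \<inter> Q k k' x)) \<le> 2 * 2 ^ n_par lam"
      using card_doubly_verifiable[OF ra, of k lam k' x] that by simp
    \<comment> \<open>All 4 ^ n strings are equally likely, so the bad ones have probability at most
      2 / 2 ^ n.\<close>
    moreover have "real (card ?L) = 2 ^ n_par lam * 2 ^ n_par lam"
      by (simp add: card_lists_of_length CARD_pauli flip: power_mult_distrib)
    moreover have "?L \<noteq> {}" using Ex_list_of_length by blast
    ultimately show ?thesis
      by (simp add: measure_pmf_of_set finite_lists_of_length field_simps)
  qed
  have "measure_pmf.prob (receiver_paulis lam)
      {P. \<exists>msg k k'. openable Ghat abt lam (P, msg) k True \<and> openable Ghat abt lam (P, msg) k' False}
    \<le> measure_pmf.prob (receiver_paulis lam) (\<Union>(k, k')\<in>?K \<times> ?K. Pi ?X (Q k k'))"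
  proof (rule measure_pmf.finite_measure_mono, rule subsetI)
    fix P assume "P \<in> {P. \<exists>msg k k'. openable Ghat abt lam (P, msg) k True \<and> openable Ghat abt lam (P, msg) k' False}"
    then obtain msg k k' where "openable Ghat abt lam (P, msg) k True" "openable Ghat abt lam (P, msg) k' False"
      by blast
    then have "k \<in> ?K" "k' \<in> ?K" "P \<in> Pi ?X (Q k k')"
      by (fastforce simp: openable_def Q_def)+
    then show "P \<in> (\<Union>(k, k')\<in>?K \<times> ?K. Pi ?X (Q k k'))" by blast
  qed simp
  also have "\<dots> \<le> (\<Sum>(k, k')\<in>?K \<times> ?K. measure_pmf.prob (receiver_paulis lam) (Pi ?X (Q k k')))"
    unfolding split_def
    by (rule measure_pmf.finite_measure_subadditive_finite) (auto simp: finite_lists_of_length)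
  also have "\<dots> \<le> (\<Sum>(k, k')\<in>?K \<times> ?K. (2 / 2 ^ n_par lam) ^ 2 ^ d_par lam)"
  proof (rule sum_mono, clarify)
    fix k k' :: "bool list" assume kk: "lam = length k" "length k' = length k"
    have "measure_pmf.prob (receiver_paulis lam) (Pi ?X (Q k k')) =
        (\<Prod>x\<in>?X. measure_pmf.prob (pmf_of_set ?L) (Q k k' x))"
      unfolding receiver_paulis_def by (rule measure_Pi_pmf_Pi[OF finite_lists_of_length])
    also have "\<dots> \<le> (\<Prod>x\<in>?X. 2 / 2 ^ n_par lam)"
      by (rule prod_mono) (use Q kk in auto)
    also have "\<dots> = (2 / 2 ^ n_par lam) ^ 2 ^ d_par lam"
      by (simp add: card_lists_of_length)
    finally show "measure_pmf.prob (receiver_paulis (length k)) (Pi {x. length x = d_par (length k)} (Q k k'))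
        \<le> (2 / 2 ^ n_par (length k)) ^ 2 ^ d_par (length k)" using kk by simp
  qed
  also have "\<dots> = 2 ^ lam * 2 ^ lam * (2 / 2 ^ n_par lam) ^ 2 ^ d_par lam"
    by (simp add: split_def card_cartesian_product card_lists_of_length)
  also have "\<dots> \<le> 2 powr (- 0.5 * real lam)"
    by (rule union_bound_estimate[OF assms(2)])
  finally show ?thesis .
qed

text \<open>An unbounded search over keys. A transcript openable to neither bit yields False; either
  answer is safe there, because every opening is then rejected up to the verification error.\<close>

definition extractor :: "(nat \<Rightarrow> circuit) \<Rightarrow> (nat \<Rightarrow> complex Matrix.vec) \<Rightarrow> nat \<Rightarrow> transcript \<Rightarrow> bool pmf" where
  "extractor Ghat abt lam \<tau> = return_pmf (\<exists>k. openable Ghat abt lam \<tau> k True)"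

text \<open>Outside \<open>?B\<close> the bit opposite to the extracted one is not openable, so it
  is accepted with probability at most \<open>?e\<close>, uniformly in the message and in the
  register kept by the sender. The event \<open>?B\<close> costs another \<open>?e\<close>.\<close>

lemma binding_game_bound:
  assumes T: "tomography_procedure T" and ra: "recognizable_abort d_par n_par G Ghat abt" and "16 \<le> lam"
  shows "measure_pmf.prob (binding_game T Ghat abt S (extractor Ghat abt) lam) {(\<mu>, b). \<mu> \<noteq> Some b \<and> \<mu> \<noteq> None}
    \<le> 2 * 2 powr (- 0.5 * real lam)"
proof -
  let ?e = "2 powr (- 0.5 * real lam)" and ?W = "{(\<mu>, b). \<mu> \<noteq> Some b \<and> \<mu> \<noteq> (None :: bool option)}"
  let ?B = "{P. \<exists>msg k k'. openable Ghat abt lam (P, msg) k True \<and> openable Ghat abt lam (P, msg) k' False}"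
  define cont where "cont P msg \<sigma> = reveal_phase T Ghat abt S lam (P, msg) \<sigma> \<bind>
      (\<lambda>\<mu>. return_pmf (\<mu>, \<exists>k. openable Ghat abt lam (P, msg) k True))" for P msg \<sigma>
  define com where "com P = run (commit_circ S lam)
      (tensor_mat (proj (ket (paulis_code lam P))) (advice S lam))" for P
  have game: "binding_game T Ghat abt S (extractor Ghat abt) lam = receiver_paulis lam \<bind>
      (\<lambda>P. measure_first (msg_len S lam) (com P) \<bind>
        (\<lambda>msg. cont P msg (post_state (msg_len S lam) (com P) msg)))"
    by (simp add: binding_game_def commit_phase_def extractor_def cont_def com_def Let_def
        bind_assoc_pmf bind_return_pmf)
  have cont: "measure_pmf.prob (cont P msg \<sigma>) ?W \<le> ?e"
    if P: "P \<in> set_pmf (receiver_paulis lam)" "P \<notin> ?B" for P msg \<sigma>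
  proof -
    define c where "c = (\<exists>k. openable Ghat abt lam (P, msg) k True)"
    \<comment> \<open>The length of the strings is a property of the support, read off the marginal
      at x.\<close>
    have len: "length (fst (P, msg) x) = n_par lam" if "length x = d_par lam" for x
    proof -
      have "P x \<in> set_pmf (map_pmf (\<lambda>P. P x) (receiver_paulis lam))" using P by simp
      moreover have "{p :: pauli list. length p = n_par lam} \<noteq> {}" using Ex_list_of_length by blast
      ultimately show ?thesis
        using that by (simp add: receiver_paulis_def Pi_pmf_component finite_lists_of_length)
    qed
    have no: "\<not> openable Ghat abt lam (P, msg) k (\<not> c)" for k
      using P(2) by (cases c) (auto simp: c_def)
    \<comment> \<open>With the extracted bit fixed to \<open>c\<close>, the sender wins exactly if
      the receiver outputs the other bit.\<close>
    have vi: "(\<lambda>\<mu>. (\<mu>, c)) -` ?W = {Some (\<not> c)}" by (auto simp: vimage_def)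
    have "measure_pmf.prob (cont P msg \<sigma>) ?W =
        measure_pmf.prob (reveal_phase T Ghat abt S lam (P, msg) \<sigma>) {Some (\<not> c)}"
      unfolding cont_def c_def[symmetric] map_pmf_def[symmetric] measure_map_pmf vi ..
    also have "\<dots> \<le> ?e"
      unfolding reveal_phase_def
      by (rule prob_bind_pmf_le_const[OF _ receiver_output_soundness[OF T ra len no]]) simp
    finally show ?thesis .
  qed
  have "measure_pmf.prob (binding_game T Ghat abt S (extractor Ghat abt) lam) ?W \<le>
      measure_pmf.prob (receiver_paulis lam) ?B * 1 + ?e"
    unfolding game
    by (rule prob_bind_pmf_le) (use cont in \<open>blast intro: prob_bind_pmf_le_const powr_ge_zero
      zero_le_one\<close>)+
  also have "\<dots> \<le> 2 * ?e"
    using equivocation_prob[OF ra assms(3)] by simp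
  finally show ?thesis .
qed

theorem lemma8p7:
  fixes G Ghat :: "nat \<Rightarrow> circuit"
    and abt :: "nat \<Rightarrow> complex Matrix.vec"
    and T :: "nat \<Rightarrow> nat \<Rightarrow> circuit"
  assumes "prfs_generator d_par n_par G"
    and "recognizable_abort d_par n_par G Ghat abt"
    and "tomography_procedure T"
  shows "\<forall>S. qpt_sender S \<longrightarrow>
    (\<exists>E :: nat \<Rightarrow> transcript \<Rightarrow> bool pmf.
      (\<lambda>lam. measure_pmf.prob (binding_game T Ghat abt S E lam)
               {(\<mu>, b). \<mu> \<noteq> Some b \<and> \<mu> \<noteq> None})
        \<in> O(\<lambda>lam. 2 powr (- 0.5 * real lam)))"
proof (intro allI impI exI)
  fix S
  show "(\<lambda>lam. measure_pmf.prob (binding_game T Ghat abt S (extractor Ghat abt) lam)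
               {(\<mu>, b). \<mu> \<noteq> Some b \<and> \<mu> \<noteq> None})
        \<in> O(\<lambda>lam. 2 powr (- 0.5 * real lam))"
    \<comment> \<open>The constant 2 adds equivocation and verification error; 16 is the threshold
      of \<open>parameter_bounds\<close>.\<close>
    by (rule bigoI[where c = 2], rule eventually_sequentiallyI[where c = 16])
      (use binding_game_bound[OF assms(3,2)] in simp)
qed

end
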